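(* Let $\Omega$ be a domain in $\mathbb{C}^n$, let $0\leq p\leq n$, $0\leq q\leq n-1$, and $\phi\in L^{\infty}(\Omega)$. Assume that $[P_{p,q},\phi]$ is compact on $A^2_{(p,q)}(\Omega)$. Then $[P_{p,q+1},\phi]$ is compact on $A^2_{(p,q+1)}(\Omega)$.
   Context: $L^2_{(p,q)}(\Omega)$ is the Hilbert space of $(p,q)$-forms $f=\sum'_{|I|=p,|J|=q}f_{IJ}\,dz_I\wedge d\overline{z}_J$ (sum over strictly increasing multi-indices) with coefficients in $L^2(\Omega)$, with $\|f\|^2=\sum'\|f_{IJ}\|^2_{L^2(\Omega)}$. $K^2_{(p,q)}(\Omega)=\{f\in L^2_{(p,q)}(\Omega):\overline{\partial}f=0\}$, where $\overline{\partial}$ is taken in the sense of distributions. $A^2_{(p,q)}(\Omega)\subset K^2_{(p,q)}(\Omega)$ is the space of $(p,q)$-forms all of whose coefficients $f_{IJ}$ are square integrable holomorphic functions on $\Omega$. $P_{p,q}$ is the Bergman projection on $(p,q)$-forms, i.e. the orthogonal projection of $L^2_{(p,q)}(\Omega)$ onto $K^2_{(p,q)}(\Omega)$ (not onto $A^2_{(p,q)}(\Omega)$). For a bounded function $\phi$, $[P_{p,q},\phi]f=P_{p,q}(\phi f)-\phi P_{p,q}f$. An operator being compact "on" a closed subspace means that its restriction to that subspace, as a map into the relevant $L^2$ space of forms, is compact. The domain $\Omega$ may be unbounded or non-pseudoconvex. *)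

theory Defs
  imports "HOL-Analysis.Analysis"
begin

text \<open>
  Points of complex n-space are vectors of type \<open>complex ^ 'n\<close>. The linear order on the index
  type is used for the signs in the exterior algebra; strictly increasing multi-indices are
  represented by the sets of their entries. A \<open>(p,q)\<close>-form is given by its coefficients:
  \<open>f I J z\<close> is the coefficient of \<open>dz\<^sub>I \<and> d(cnj z)\<^sub>J\<close> at \<open>z\<close>. Only the values with \<open>card I = p\<close>,
  \<open>card J = q\<close> and \<open>z \<in> \<Omega>\<close> carry information. As usual for \<open>L\<^sup>2\<close>, forms that agree almost
  everywhere are identified; here this means that they have distance zero in \<open>form_norm\<close>.
\<close>

type_synonym 'n cvec = "complex ^ 'n"

type_synonym 'n form = "'n set \<Rightarrow> 'n set \<Rightarrow> 'n cvec \<Rightarrow> complex"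

definition multi_indices :: "nat \<Rightarrow> nat \<Rightarrow> ('n::finite set \<times> 'n set) set" where
  "multi_indices p q = {(I, J). card I = p \<and> card J = q}"

subsection \<open>Square integrable forms\<close>

definition square_integrable :: "'n cvec set \<Rightarrow> ('n::finite cvec \<Rightarrow> complex) \<Rightarrow> bool" where
  "square_integrable \<Omega> u \<longleftrightarrow>
     u \<in> borel_measurable (lebesgue_on \<Omega>) \<and> integrable (lebesgue_on \<Omega>) (\<lambda>z. (cmod (u z))\<^sup>2)"

definition L2_forms :: "nat \<Rightarrow> nat \<Rightarrow> 'n cvec set \<Rightarrow> 'n::finite form set" where
  "L2_forms p q \<Omega> = {f. \<forall>(I, J) \<in> multi_indices p q. square_integrable \<Omega> (f I J)}"

definition form_inner ::
    "nat \<Rightarrow> nat \<Rightarrow> 'n cvec set \<Rightarrow> 'n::finite form \<Rightarrow> 'n form \<Rightarrow> complex" where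
  "form_inner p q \<Omega> f g =
     (\<Sum>(I, J) \<in> multi_indices p q. integral\<^sup>L (lebesgue_on \<Omega>) (\<lambda>z. f I J z * cnj (g I J z)))"

definition form_norm :: "nat \<Rightarrow> nat \<Rightarrow> 'n cvec set \<Rightarrow> 'n::finite form \<Rightarrow> real" where
  "form_norm p q \<Omega> f =
     sqrt (\<Sum>(I, J) \<in> multi_indices p q. integral\<^sup>L (lebesgue_on \<Omega>) (\<lambda>z. (cmod (f I J z))\<^sup>2))"

definition form_diff :: "'n form \<Rightarrow> 'n form \<Rightarrow> 'n form" where
  "form_diff f g = (\<lambda>I J z. f I J z - g I J z)"

definition form_mult :: "('n cvec \<Rightarrow> complex) \<Rightarrow> 'n form \<Rightarrow> 'n form" where
  "form_mult \<phi> f = (\<lambda>I J z. \<phi> z * f I J z)"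

definition L_infinity :: "'n cvec set \<Rightarrow> ('n::finite cvec \<Rightarrow> complex) set" where
  "L_infinity \<Omega> =
     {\<phi>. \<phi> \<in> borel_measurable (lebesgue_on \<Omega>) \<and> (\<exists>C. AE z in lebesgue_on \<Omega>. cmod (\<phi> z) \<le> C)}"

subsection \<open>The distributional Cauchy-Riemann operator\<close>

primrec Ck :: "nat \<Rightarrow> ('n::finite cvec \<Rightarrow> complex) \<Rightarrow> bool" where
  "Ck 0 u \<longleftrightarrow> continuous_on UNIV u"
| "Ck (Suc m) u \<longleftrightarrow>
     (\<forall>z. u differentiable (at z)) \<and> (\<forall>v. Ck m (\<lambda>z. frechet_derivative u (at z) v))"

definition test_functions :: "'n::finite cvec set \<Rightarrow> ('n cvec \<Rightarrow> complex) set" where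
  "test_functions \<Omega> =
     {\<psi>. (\<forall>m. Ck m \<psi>) \<and> compact (closure {z. \<psi> z \<noteq> 0}) \<and> closure {z. \<psi> z \<noteq> 0} \<subseteq> \<Omega>}"

text \<open>The Wirtinger derivative \<open>\<partial>/\<partial>(cnj z\<^sub>k) = (\<partial>/\<partial>x\<^sub>k + \<i> \<partial>/\<partial>y\<^sub>k) / 2\<close>.\<close>

definition wirtinger_bar :: "'n \<Rightarrow> ('n::finite cvec \<Rightarrow> complex) \<Rightarrow> 'n cvec \<Rightarrow> complex" where
  "wirtinger_bar k \<psi> z =
     (frechet_derivative \<psi> (at z) (axis k 1) + \<i> * frechet_derivative \<psi> (at z) (axis k \<i>)) / 2"

definition distr_wirtinger_bar ::
    "'n cvec set \<Rightarrow> 'n \<Rightarrow> ('n::finite cvec \<Rightarrow> complex) \<Rightarrow> ('n cvec \<Rightarrow> complex) \<Rightarrow> complex"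
  where
  "distr_wirtinger_bar \<Omega> k u \<psi> = - integral\<^sup>L (lebesgue_on \<Omega>) (\<lambda>z. u z * wirtinger_bar k \<psi> z)"

text \<open>
  For a \<open>(p,q)\<close>-form \<open>f\<close> one has
  \<open>dbar f = \<Sum>\<^sub>k \<Sum>\<^sub>I\<^sub>J (\<partial>f\<^sub>I\<^sub>J/\<partial>(cnj z\<^sub>k)) d(cnj z\<^sub>k) \<and> dz\<^sub>I \<and> d(cnj z)\<^sub>J\<close>. Moving \<open>d(cnj z\<^sub>k)\<close> to its place in the
  increasing order past the \<open>p\<close> factors of \<open>dz\<^sub>I\<close> and the factors \<open>d(cnj z\<^sub>j)\<close> with \<open>j < k\<close> gives the
  sign below. The value \<open>dbar p \<Omega> f I M \<psi>\<close> is the pairing of the \<open>(I, M)\<close> coefficient of the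
  distributional \<open>dbar f\<close> with the test function \<open>\<psi>\<close>, for \<open>card M = q + 1\<close>.
\<close>

definition dbar ::
    "nat \<Rightarrow> 'n cvec set \<Rightarrow> 'n::{finite,linorder} form \<Rightarrow>
     'n set \<Rightarrow> 'n set \<Rightarrow> ('n cvec \<Rightarrow> complex) \<Rightarrow> complex" where
  "dbar p \<Omega> f I M \<psi> =
     (\<Sum>k\<in>M. (-1) ^ (p + card {j\<in>M. j < k}) * distr_wirtinger_bar \<Omega> k (f I (M - {k})) \<psi>)"

definition K2_forms :: "nat \<Rightarrow> nat \<Rightarrow> 'n cvec set \<Rightarrow> 'n::{finite,linorder} form set" where
  "K2_forms p q \<Omega> =
     {f \<in> L2_forms p q \<Omega>. \<forall>(I, M) \<in> multi_indices p (q + 1). \<forall>\<psi> \<in> test_functions \<Omega>.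
        dbar p \<Omega> f I M \<psi> = 0}"

subsection \<open>Forms with holomorphic coefficients\<close>

text \<open>Holomorphy in several variables: the real derivative exists and is complex linear.\<close>

definition holomorphic_Cn :: "'n cvec set \<Rightarrow> ('n::finite cvec \<Rightarrow> complex) \<Rightarrow> bool" where
  "holomorphic_Cn \<Omega> u \<longleftrightarrow>
     (\<forall>z\<in>\<Omega>. \<exists>D. (u has_derivative D) (at z) \<and> (\<forall>c v. D (c *s v) = c * D v))"

definition A2_forms :: "nat \<Rightarrow> nat \<Rightarrow> 'n cvec set \<Rightarrow> 'n::finite form set" where
  "A2_forms p q \<Omega> =
     {f \<in> L2_forms p q \<Omega>. \<forall>(I, J) \<in> multi_indices p q. holomorphic_Cn \<Omega> (f I J)}"

subsection \<open>The Bergman projection and compactness of its commutators\<close>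

text \<open>
  The orthogonal projection onto the closed subspace \<open>K2_forms p q \<Omega>\<close>, which determines its value
  up to equality almost everywhere.
\<close>

definition bergman_proj ::
    "nat \<Rightarrow> nat \<Rightarrow> 'n cvec set \<Rightarrow> 'n::{finite,linorder} form \<Rightarrow> 'n form" where
  "bergman_proj p q \<Omega> f =
     (SOME g. g \<in> K2_forms p q \<Omega> \<and> (\<forall>h \<in> K2_forms p q \<Omega>. form_inner p q \<Omega> (form_diff f g) h = 0))"

definition bergman_commutator ::
    "nat \<Rightarrow> nat \<Rightarrow> 'n cvec set \<Rightarrow> ('n cvec \<Rightarrow> complex) \<Rightarrow>
     'n::{finite,linorder} form \<Rightarrow> 'n form" where
  "bergman_commutator p q \<Omega> \<phi> f =
     form_diff (bergman_proj p q \<Omega> (form_mult \<phi> f)) (form_mult \<phi> (bergman_proj p q \<Omega> f))"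

text \<open>
  Compactness of the restriction of a linear operator \<open>T\<close> to a subspace \<open>S\<close> of the \<open>(p,q)\<close>-forms,
  as a map into the square integrable \<open>(p,q)\<close>-forms: images of bounded sequences have convergent
  subsequences.
\<close>

definition compact_operator_on ::
    "nat \<Rightarrow> nat \<Rightarrow> 'n cvec set \<Rightarrow> ('n::finite form \<Rightarrow> 'n form) \<Rightarrow> 'n form set \<Rightarrow> bool" where
  "compact_operator_on p q \<Omega> T S \<longleftrightarrow>
     T ` S \<subseteq> L2_forms p q \<Omega> \<and>
     (\<forall>F :: nat \<Rightarrow> 'n form. (\<forall>j. F j \<in> S) \<and> (\<exists>C. \<forall>j. form_norm p q \<Omega> (F j) \<le> C) \<longrightarrow>
        (\<exists>r g. strict_mono r \<and> g \<in> L2_forms p q \<Omega> \<and>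
           (\<lambda>j. form_norm p q \<Omega> (form_diff (T (F (r j))) g)) \<longlonglongrightarrow> 0))"

end

theory Submission
  imports Defs "HOL-Library.Function_Algebras" "HOL-Complex_Analysis.Complex_Analysis"
begin

text \<open>
  Write \<open>T\<^sub>q = [P\<^sub>p\<^sub>,\<^sub>q, \<phi>]\<close> and let \<open>e\<^sub>k f\<close> stand for \<open>d(cnj z\<^sub>k) \<and> f\<close>. For a \<open>dbar\<close>-closed form \<open>f\<close> one has
  \<open>T\<^sub>q f = P(\<phi> f) - \<phi> f\<close>, so that \<open>-T\<^sub>q f\<close> is the component of \<open>\<phi> f\<close> orthogonal to the closed forms, and
  closed forms may be added to \<open>\<phi> f\<close> without changing this component. Such closed forms come from
  degree \<open>q\<close>: since \<open>dbar\<close> anticommutes with \<open>e\<^sub>k\<close>, the operator \<open>e\<^sub>k\<close> maps closed \<open>(p,q)\<close>-forms to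
  closed \<open>(p,q+1)\<close>-forms (\<open>wedge_dzbar_K2\<close>).

  Given \<open>F\<close> of degree \<open>(p,q+1)\<close> with holomorphic coefficients, the contractions
  \<open>G\<^sub>k = 1/(q+1) \<iota>\<^sub>k F\<close> have degree \<open>(p,q)\<close> and holomorphic coefficients, and \<open>F = \<Sum>\<^sub>k e\<^sub>k G\<^sub>k\<close>
  (\<open>sum_wedge_contract\<close>). Multiplication by \<open>\<phi>\<close> commutes with \<open>e\<^sub>k\<close>, whence
  \<open>\<Sum>\<^sub>k e\<^sub>k T\<^sub>q G\<^sub>k = \<Sum>\<^sub>k e\<^sub>k P(\<phi> G\<^sub>k) - \<phi> F\<close>, and the first sum on the right is closed. Applying \<open>1 - P\<close> gives
  \<open>T\<^sub>q\<^sub>+\<^sub>1 F = (1 - P) \<Sum>\<^sub>k e\<^sub>k T\<^sub>q G\<^sub>k\<close>. This is a finite sum of operators in which the compact operator \<open>T\<^sub>q\<close>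
  is composed with bounded ones, hence compact. The quantitative form is \<open>commutator_estimate\<close>: if
  \<open>T\<^sub>q G\<^sub>k\<close> is close to \<open>H\<^sub>k\<close> for every \<open>k\<close>, then \<open>T\<^sub>q\<^sub>+\<^sub>1 F\<close> is close to \<open>(1 - P) \<Sum>\<^sub>k e\<^sub>k H\<^sub>k\<close>.

  Two analytic facts support this algebra. The Bergman projection exists, because the square
  integrable forms are complete and the closed forms are the orthogonal complement of a set of
  forms (\<open>dbar_eq_form_inner\<close>, \<open>K2_projection_exists\<close>). Forms with holomorphic coefficients are closed
  in the sense of distributions, by integration by parts; the one-variable Cauchy estimate supplies
  the bounds on the derivatives which this requires (\<open>holomorphic_distr_wirtinger_bar_zero\<close>).

  Forms are added and subtracted pointwise; multiplication by a scalar \<open>c\<close> is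
  \<open>form_mult (\<lambda>_. c)\<close>. Equalities that hold only almost everywhere, such as \<open>P f = f\<close> for
  closed \<open>f\<close>, appear as statements about differences of norm zero.
\<close>

section \<open>Square integrable functions\<close>

lemma square_integrable_measurable:
  "square_integrable \<Omega> u \<Longrightarrow> u \<in> borel_measurable (lebesgue_on \<Omega>)"
  by (simp add: square_integrable_def)

lemma cmod_add_square_le: "(cmod (a + b))\<^sup>2 \<le> 2 * (cmod a)\<^sup>2 + 2 * (cmod b)\<^sup>2"
proof -
  have "(cmod (a + b))\<^sup>2 \<le> (cmod a + cmod b)\<^sup>2"
    by (intro power_mono norm_triangle_ineq) simp
  also have "\<dots> \<le> 2 * (cmod a)\<^sup>2 + 2 * (cmod b)\<^sup>2"
    using zero_le_power2[of "cmod a - cmod b"] by (simp add: power2_sum power2_diff)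
  finally show ?thesis .
qed

lemma square_integrable_add:
  assumes "square_integrable \<Omega> u" "square_integrable \<Omega> v"
  shows "square_integrable \<Omega> (\<lambda>z. u z + v z)"
proof -
  note [measurable] = assms[THEN square_integrable_measurable]
  have "integrable (lebesgue_on \<Omega>) (\<lambda>z. 2 * (cmod (u z))\<^sup>2 + 2 * (cmod (v z))\<^sup>2)"
    using assms by (simp add: square_integrable_def)
  then have "integrable (lebesgue_on \<Omega>) (\<lambda>z. (cmod (u z + v z))\<^sup>2)"
    by (rule Bochner_Integration.integrable_bound)
      (measurable, use cmod_add_square_le in auto)
  then show ?thesis
    by (simp add: square_integrable_def)
qed

lemma square_integrable_mult_bounded:
  assumes "\<phi> \<in> L_infinity \<Omega>" "square_integrable \<Omega> u"
  shows "square_integrable \<Omega> (\<lambda>z. \<phi> z * u z)"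
proof -
  obtain C where [measurable]: "\<phi> \<in> borel_measurable (lebesgue_on \<Omega>)"
    and C: "AE z in lebesgue_on \<Omega>. cmod (\<phi> z) \<le> C"
    using assms(1) by (auto simp: L_infinity_def)
  note [measurable] = assms(2)[THEN square_integrable_measurable]
  have int: "integrable (lebesgue_on \<Omega>) (\<lambda>z. C\<^sup>2 * (cmod (u z))\<^sup>2)"
    using assms by (simp add: square_integrable_def)
  have meas: "(\<lambda>z. (cmod (\<phi> z * u z))\<^sup>2) \<in> borel_measurable (lebesgue_on \<Omega>)"
    by measurable
  have "AE z in lebesgue_on \<Omega>. norm ((cmod (\<phi> z * u z))\<^sup>2) \<le> norm (C\<^sup>2 * (cmod (u z))\<^sup>2)"
    using C
  proof eventually_elim
    case (elim z)
    have "(cmod (\<phi> z))\<^sup>2 \<le> C\<^sup>2"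
      using elim by (intro power_mono) auto
    then show ?case
      by (simp add: norm_mult power_mult_distrib mult_right_mono)
  qed
  then have "integrable (lebesgue_on \<Omega>) (\<lambda>z. (cmod (\<phi> z * u z))\<^sup>2)"
    by (rule Bochner_Integration.integrable_bound[OF int meas])
  then show ?thesis
    by (simp add: square_integrable_def)
qed

lemma const_L_infinity: "(\<lambda>_. c) \<in> L_infinity \<Omega>"
  by (auto simp: L_infinity_def)

lemma square_integrable_zero: "square_integrable \<Omega> (\<lambda>_. 0)"
  by (simp add: square_integrable_def)

lemma square_integrable_scale:
  "square_integrable \<Omega> u \<Longrightarrow> square_integrable \<Omega> (\<lambda>z. c * u z)"
  using square_integrable_mult_bounded[OF const_L_infinity] .

lemma square_integrable_diff:
  assumes "square_integrable \<Omega> u" "square_integrable \<Omega> v"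
  shows "square_integrable \<Omega> (\<lambda>z. u z - v z)"
  using square_integrable_add[OF assms(1) square_integrable_scale[OF assms(2), of "-1"]] by simp

lemma square_integrable_sum:
  "(\<And>i. i \<in> A \<Longrightarrow> square_integrable \<Omega> (u i)) \<Longrightarrow> square_integrable \<Omega> (\<lambda>z. \<Sum>i\<in>A. u i z)"
  by (induction A rule: infinite_finite_induct)
    (auto intro: square_integrable_zero square_integrable_add)

lemma square_integrable_cnj: "square_integrable \<Omega> u \<Longrightarrow> square_integrable \<Omega> (\<lambda>z. cnj (u z))"
  by (auto simp: square_integrable_def intro!: borel_measurable_continuous_on[where f = cnj] continuous_intros)

lemma integrable_mult_square_integrable:
  assumes "square_integrable \<Omega> u" "square_integrable \<Omega> v"
  shows "integrable (lebesgue_on \<Omega>) (\<lambda>z. u z * v z)"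
proof -
  note [measurable] = assms[THEN square_integrable_measurable]
  have "integrable (lebesgue_on \<Omega>) (\<lambda>z. (cmod (u z))\<^sup>2 + (cmod (v z))\<^sup>2)"
    using assms by (simp add: square_integrable_def)
  then show ?thesis
  proof (rule Bochner_Integration.integrable_bound)
    have "norm (u z * v z) \<le> (cmod (u z))\<^sup>2 + (cmod (v z))\<^sup>2" for z
    proof -
      have "cmod (u z) * cmod (v z) \<le> (cmod (u z))\<^sup>2 + (cmod (v z))\<^sup>2"
        using zero_le_power2[of "cmod (u z) - cmod (v z)"] mult_nonneg_nonneg[OF norm_ge_zero norm_ge_zero, of "u z" "v z"] 
        unfolding power2_diff by linarith
      then show ?thesis by (simp add: norm_mult)
    qed
    then show "AE z in lebesgue_on \<Omega>. norm (u z * v z) \<le> norm ((cmod (u z))\<^sup>2 + (cmod (v z))\<^sup>2)"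
      by (intro AE_I2) simp
  qed measurable
qed

lemma nn_integral_cmod_square:
  "square_integrable \<Omega> u \<Longrightarrow>
    (\<integral>\<^sup>+z. ennreal ((cmod (u z))\<^sup>2) \<partial>lebesgue_on \<Omega>) = ennreal (\<integral>z. (cmod (u z))\<^sup>2 \<partial>lebesgue_on \<Omega>)"
  by (rule nn_integral_eq_integral) (auto simp: square_integrable_def)

text \<open>
  The Riesz--Fischer theorem. A subsequence whose consecutive differences have squared norms at
  most \<open>4\<^sup>-\<^sup>k\<close> converges almost everywhere. Weighting the squares of the differences with \<open>2\<^sup>k\<close> still
  gives an integrable sum, so almost everywhere the differences are \<open>O(2\<^sup>-\<^sup>k\<^sup>/\<^sup>2)\<close>; this replaces the
  triangle inequality for the \<open>L\<^sup>2\<close> norm of a sum. Fatou's lemma turns the almost everywhere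
  convergence of the subsequence into convergence of the whole sequence in norm.
\<close>

lemma square_integrable_complete:
  assumes u: "\<And>n. square_integrable \<Omega> (u n)"
    and cauchy: "\<And>e. e > 0 \<Longrightarrow> \<exists>N. \<forall>m\<ge>N. \<forall>n\<ge>N. (\<integral>z. (cmod (u m z - u n z))\<^sup>2 \<partial>lebesgue_on \<Omega>) \<le> e"
  shows "\<exists>v. square_integrable \<Omega> v \<and>
    (\<lambda>n. \<integral>z. (cmod (u n z - v z))\<^sup>2 \<partial>lebesgue_on \<Omega>) \<longlonglongrightarrow> 0"
proof -
  let ?M = "lebesgue_on \<Omega>"
  note [measurable] = u[THEN square_integrable_measurable]
  have diff: "square_integrable \<Omega> (\<lambda>z. u m z - u n z)" for m n
    by (intro square_integrable_diff u)
  obtain N where N: "\<And>k m n. m \<ge> N k \<Longrightarrow> n \<ge> N k \<Longrightarrow>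
      (\<integral>z. (cmod (u m z - u n z))\<^sup>2 \<partial>?M) \<le> (1/4) ^ k"
  proof -
    have "\<forall>k. \<exists>N. \<forall>m\<ge>N. \<forall>n\<ge>N. (\<integral>z. (cmod (u m z - u n z))\<^sup>2 \<partial>?M) \<le> (1/4) ^ k"
      by (intro allI cauchy) simp
    from choice[OF this] show ?thesis
      using that by blast
  qed
  define r where "r k = (\<Sum>i\<le>k. Suc (N i))" for k
  have r_ge: "r k \<ge> N k" for k
    unfolding r_def by (rule order_trans[OF _ member_le_sum[of k]]) auto
  have "strict_mono r"
    by (rule strict_monoI_Suc) (simp add: r_def)
  have r_Suc_ge: "r (Suc k) \<ge> N k" for k
    using \<open>strict_mono r\<close> r_ge[of k] by (meson lessI order_trans order.strict_implies_order strict_monoD)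
  have step: "(\<integral>z. (cmod (u (r (Suc k)) z - u (r k) z))\<^sup>2 \<partial>?M) \<le> (1/4) ^ k" for k
    by (rule N[OF r_Suc_ge r_ge])
  define d where "d k z = 2 ^ k * (cmod (u (r (Suc k)) z - u (r k) z))\<^sup>2" for k z
  have [measurable]: "d k \<in> borel_measurable ?M" for k
    unfolding d_def by measurable
  have d_nonneg: "0 \<le> d k z" for k z
    by (simp add: d_def)
  have "(\<integral>\<^sup>+z. (\<Sum>k. ennreal (d k z)) \<partial>?M) = (\<Sum>k. \<integral>\<^sup>+z. ennreal (d k z) \<partial>?M)"
    by (rule nn_integral_suminf) measurable
  also have "\<dots> \<le> (\<Sum>k. ennreal ((1/2) ^ k))"
  proof (intro suminf_le)
    fix k
    have "(\<integral>\<^sup>+z. ennreal (d k z) \<partial>?M) =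
        2 ^ k * (\<integral>\<^sup>+z. ennreal ((cmod (u (r (Suc k)) z - u (r k) z))\<^sup>2) \<partial>?M)"
      by (subst nn_integral_cmult[symmetric])
        (auto simp: d_def ennreal_mult ennreal_power[symmetric] intro!: nn_integral_cong)
    also have "\<dots> = ennreal (2 ^ k * (\<integral>z. (cmod (u (r (Suc k)) z - u (r k) z))\<^sup>2 \<partial>?M))"
      unfolding nn_integral_cmod_square[OF diff] by (simp add: ennreal_mult ennreal_power[symmetric])
    also have "\<dots> \<le> ennreal (2 ^ k * (1/4) ^ k)"
      by (intro ennreal_leI mult_left_mono step) simp
    also have "2 ^ k * (1/4) ^ k = ((1/2) ^ k :: real)"
      by (simp add: power_mult_distrib[symmetric])
    finally show "(\<integral>\<^sup>+z. ennreal (d k z) \<partial>?M) \<le> ennreal ((1/2) ^ k)" .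
  qed auto
  also have "\<dots> = ennreal (\<Sum>k. (1/2) ^ k)"
    by (rule suminf_ennreal2) (auto intro: summable_geometric)
  also have "\<dots> < \<infinity>"
    by simp
  finally have "AE z in ?M. (\<Sum>k. ennreal (d k z)) \<noteq> \<infinity>"
    by (intro nn_integral_PInf_AE) auto
  then have conv: "AE z in ?M. convergent (\<lambda>k. u (r k) z)"
  proof eventually_elim
    case (elim z)
    then have "summable (\<lambda>k. d k z)"
      by (intro summable_suminf_not_top) (auto simp: d_nonneg)
    then have "Bseq (\<lambda>k. d k z)"
      by (intro convergent_imp_Bseq convergentI[OF summable_LIMSEQ_zero])
    then obtain C where "\<And>k. norm (d k z) \<le> C"
      by (auto simp: Bseq_def)
    then have C: "d k z \<le> C" for k
      by (metis abs_le_D1 real_norm_def)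
    \<comment> \<open>The bound \<open>d k z \<le> C\<close> says that the difference is at most \<open>sqrt C * q ^ k\<close>, a geometric majorant.\<close>
    define q where "q = sqrt (1/2 :: real)"
    have q: "0 \<le> q" "q < 1"
      by (auto simp: q_def real_less_lsqrt)
    have "cmod (u (r (Suc k)) z - u (r k) z) \<le> sqrt C * q ^ k" for k
    proof (rule power2_le_imp_le)
      have "(cmod (u (r (Suc k)) z - u (r k) z))\<^sup>2 = d k z * (1/2) ^ k"
        by (simp add: d_def power_one_over)
      also have "\<dots> \<le> C * (1/2) ^ k"
        by (intro mult_right_mono C) simp
      also have "\<dots> = (sqrt C * q ^ k)\<^sup>2"
        using d_nonneg[of 0 z] C[of 0]
        by (simp add: q_def power_mult_distrib power_mult[symmetric] mult.commute[of k])
          (simp add: power_mult)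
      finally show "(cmod (u (r (Suc k)) z - u (r k) z))\<^sup>2 \<le> (sqrt C * q ^ k)\<^sup>2" .
      show "0 \<le> sqrt C * q ^ k"
        using d_nonneg[of 0 z] C[of 0] q by simp
    qed
    note bound = this
    have "summable (\<lambda>k. sqrt C * q ^ k)"
      by (intro summable_mult summable_geometric) (use q in simp)
    then have "summable (\<lambda>k. u (r (Suc k)) z - u (r k) z)"
      by (rule summable_comparison_test'[where N = 0]) (rule bound)
    then have "(\<lambda>n. \<Sum>k<n. u (r (Suc k)) z - u (r k) z) \<longlonglongrightarrow> (\<Sum>k. u (r (Suc k)) z - u (r k) z)"
      by (rule summable_LIMSEQ)
    then have "(\<lambda>n. u (r n) z - u (r 0) z) \<longlonglongrightarrow> (\<Sum>k. u (r (Suc k)) z - u (r k) z)"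
      by (subst (asm) sum_lessThan_telescope)
    from tendsto_add[OF this tendsto_const[of "u (r 0) z"]]
    show ?case
      by (auto simp: convergent_def)
  qed
  define v where "v z = lim (\<lambda>k. u (r k) z)" for z
  have [measurable]: "v \<in> borel_measurable ?M"
    unfolding v_def by measurable
  have lim: "AE z in ?M. (\<lambda>k. u (r k) z) \<longlonglongrightarrow> v z"
    using conv by eventually_elim (simp add: v_def convergent_LIMSEQ_iff)
  have fatou: "(\<integral>\<^sup>+z. ennreal ((cmod (u n z - v z))\<^sup>2) \<partial>?M) \<le> ennreal e"
    if "\<And>m. m \<ge> K \<Longrightarrow> (\<integral>z. (cmod (u n z - u m z))\<^sup>2 \<partial>?M) \<le> e" for n e K
  proof -
    have "(\<integral>\<^sup>+z. ennreal ((cmod (u n z - v z))\<^sup>2) \<partial>?M) =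
        (\<integral>\<^sup>+z. liminf (\<lambda>k. ennreal ((cmod (u n z - u (r k) z))\<^sup>2)) \<partial>?M)"
      using lim
    proof (intro nn_integral_cong_AE, eventually_elim)
      case (elim z)
      then have "(\<lambda>k. ennreal ((cmod (u n z - u (r k) z))\<^sup>2)) \<longlonglongrightarrow> ennreal ((cmod (u n z - v z))\<^sup>2)"
        by (intro tendsto_intros tendsto_ennrealI)
      then show ?case
        by (rule lim_imp_Liminf[OF trivial_limit_sequentially, symmetric])
    qed
    also have "\<dots> \<le> liminf (\<lambda>k. \<integral>\<^sup>+z. ennreal ((cmod (u n z - u (r k) z))\<^sup>2) \<partial>?M)"
      by (rule nn_integral_liminf) measurable
    also have "\<dots> \<le> liminf (\<lambda>k. ennreal e)"
    proof (rule Liminf_mono, unfold eventually_sequentially, intro exI allI impI)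
      fix k assume "k \<ge> K"
      then have "r k \<ge> K"
        using seq_suble[OF \<open>strict_mono r\<close>, of k] by simp
      then show "(\<integral>\<^sup>+z. ennreal ((cmod (u n z - u (r k) z))\<^sup>2) \<partial>?M) \<le> ennreal e"
        unfolding nn_integral_cmod_square[OF diff] by (intro ennreal_leI that)
    qed
    also have "\<dots> = ennreal e"
      by (simp add: Liminf_const)
    finally show ?thesis .
  qed
  have diff_v: "square_integrable \<Omega> (\<lambda>z. u n z - v z)" if "n \<ge> N 0" for n
  proof -
    have "(\<integral>\<^sup>+z. ennreal ((cmod (u n z - v z))\<^sup>2) \<partial>?M) \<le> ennreal 1"
      using N[of 0 n] that by (intro fatou[of "N 0"]) auto
    then show ?thesis
      unfolding square_integrable_def
      by (intro conjI integrableI_bounded) (auto simp: le_less_trans)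
  qed
  have "square_integrable \<Omega> v"
    using square_integrable_diff[OF u[of "N 0"] diff_v[of "N 0"]] by simp
  moreover have "(\<lambda>n. \<integral>z. (cmod (u n z - v z))\<^sup>2 \<partial>?M) \<longlonglongrightarrow> 0"
  proof (rule LIMSEQ_I)
    fix e :: real assume "e > 0"
    then obtain K where K: "\<And>m n. m \<ge> K \<Longrightarrow> n \<ge> K \<Longrightarrow> (\<integral>z. (cmod (u m z - u n z))\<^sup>2 \<partial>?M) \<le> e / 2"
      using cauchy[of "e / 2"] by auto
    have "norm ((\<integral>z. (cmod (u n z - v z))\<^sup>2 \<partial>?M) - 0) < e" if "n \<ge> max K (N 0)" for n
    proof -
      have "ennreal (\<integral>z. (cmod (u n z - v z))\<^sup>2 \<partial>?M) \<le> ennreal (e / 2)"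
        using that K by (subst nn_integral_cmod_square[symmetric, OF diff_v]) (auto intro!: fatou[of K])
      then show ?thesis
        using \<open>e > 0\<close> by (simp add: ennreal_le_iff)
    qed
    then show "\<exists>K. \<forall>n\<ge>K. norm ((\<integral>z. (cmod (u n z - v z))\<^sup>2 \<partial>?M) - 0) < e"
      by blast
  qed
  ultimately show ?thesis
    by blast
qed


section \<open>The Hilbert space of square integrable forms\<close>

lemma finite_multi_indices [simp]: "finite (multi_indices p q)"
  by (rule finite_subset[OF subset_UNIV]) simp

lemma form_diff_eq_minus: "form_diff f g = f - g"
  by (simp add: form_diff_def fun_eq_iff)

lemma form_mult_apply [simp]: "form_mult \<phi> f I J z = \<phi> z * f I J z"
  by (simp add: form_mult_def)

lemma sum_fun_apply: "(\<Sum>i\<in>A. f i) x = (\<Sum>i\<in>A. f i x)"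
  by (induction A rule: infinite_finite_induct) auto

lemma form_mult_diff: "form_mult \<phi> (f - g) = form_mult \<phi> f - form_mult \<phi> g"
  by (simp add: fun_eq_iff algebra_simps)

lemma L2_forms_component:
  "f \<in> L2_forms p q \<Omega> \<Longrightarrow> (I, J) \<in> multi_indices p q \<Longrightarrow> square_integrable \<Omega> (f I J)"
  by (auto simp: L2_forms_def)

lemma L2_formsI:
  "(\<And>I J. (I, J) \<in> multi_indices p q \<Longrightarrow> square_integrable \<Omega> (f I J)) \<Longrightarrow> f \<in> L2_forms p q \<Omega>"
  by (auto simp: L2_forms_def)

lemma L2_forms_add:
  "f \<in> L2_forms p q \<Omega> \<Longrightarrow> g \<in> L2_forms p q \<Omega> \<Longrightarrow> f + g \<in> L2_forms p q \<Omega>"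
  by (auto simp: L2_forms_def plus_fun_def intro!: square_integrable_add)

lemma L2_forms_diff:
  "f \<in> L2_forms p q \<Omega> \<Longrightarrow> g \<in> L2_forms p q \<Omega> \<Longrightarrow> f - g \<in> L2_forms p q \<Omega>"
  by (auto simp: L2_forms_def fun_diff_def intro!: square_integrable_diff)

lemma L2_forms_mult:
  "\<phi> \<in> L_infinity \<Omega> \<Longrightarrow> f \<in> L2_forms p q \<Omega> \<Longrightarrow> form_mult \<phi> f \<in> L2_forms p q \<Omega>"
  by (auto simp: L2_forms_def form_mult_def intro!: square_integrable_mult_bounded)

lemma L2_forms_zero: "0 \<in> L2_forms p q \<Omega>"
  by (auto simp: L2_forms_def zero_fun_def square_integrable_zero)

lemma L2_forms_sum:
  "(\<And>i. i \<in> A \<Longrightarrow> f i \<in> L2_forms p q \<Omega>) \<Longrightarrow> (\<Sum>i\<in>A. f i) \<in> L2_forms p q \<Omega>"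
  by (induction A rule: infinite_finite_induct) (auto intro: L2_forms_zero L2_forms_add)

lemma form_norm_nonneg [simp]: "0 \<le> form_norm p q \<Omega> f"
  unfolding form_norm_def by (intro real_sqrt_ge_zero sum_nonneg) (auto intro!: integral_nonneg)

lemma form_norm_square:
  "(form_norm p q \<Omega> f)\<^sup>2 =
    (\<Sum>(I, J) \<in> multi_indices p q. \<integral>z. (cmod (f I J z))\<^sup>2 \<partial>lebesgue_on \<Omega>)"
  unfolding form_norm_def
  by (intro real_sqrt_pow2 sum_nonneg) (auto intro!: integral_nonneg)

lemma component_norm_le:
  assumes "(I, J) \<in> multi_indices p q"
  shows "(\<integral>z. (cmod (f I J z))\<^sup>2 \<partial>lebesgue_on \<Omega>) \<le> (form_norm p q \<Omega> f)\<^sup>2"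
  unfolding form_norm_square
  using member_le_sum[OF assms, of "\<lambda>(I, J). \<integral>z. (cmod (f I J z))\<^sup>2 \<partial>lebesgue_on \<Omega>"]
  by (auto intro!: integral_nonneg)

text \<open>
  The integrals in \<open>form_inner\<close> exist, which makes it additive: the integral of a non-integrable
  function is zero by convention.
\<close>

lemma integrable_component_product:
  assumes "f \<in> L2_forms p q \<Omega>" "g \<in> L2_forms p q \<Omega>" "(I, J) \<in> multi_indices p q"
  shows "integrable (lebesgue_on \<Omega>) (\<lambda>z. f I J z * cnj (g I J z))"
  using assms by (intro integrable_mult_square_integrable square_integrable_cnj L2_forms_component)

lemma form_inner_add_left:
  assumes "f \<in> L2_forms p q \<Omega>" "g \<in> L2_forms p q \<Omega>" "h \<in> L2_forms p q \<Omega>"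
  shows "form_inner p q \<Omega> (f + g) h = form_inner p q \<Omega> f h + form_inner p q \<Omega> g h"
  unfolding form_inner_def sum.distrib[symmetric]
  using assms by (intro sum.cong refl) (auto simp: distrib_right integrable_component_product)

lemma form_inner_scale_left:
  "form_inner p q \<Omega> (form_mult (\<lambda>_. c) f) h = c * form_inner p q \<Omega> f h"
  unfolding form_inner_def sum_distrib_left by (intro sum.cong refl) (auto simp: mult.assoc)

lemma form_inner_commute: "form_inner p q \<Omega> g f = cnj (form_inner p q \<Omega> f g)"
  unfolding form_inner_def cnj_sum
  by (intro sum.cong refl) (auto simp flip: Bochner_Integration.integral_cnj simp: mult.commute)

lemma form_inner_diff_left:
  assumes "f \<in> L2_forms p q \<Omega>" "g \<in> L2_forms p q \<Omega>" "h \<in> L2_forms p q \<Omega>"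
  shows "form_inner p q \<Omega> (f - g) h = form_inner p q \<Omega> f h - form_inner p q \<Omega> g h"
  using form_inner_add_left[OF L2_forms_diff[OF assms(1,2)] assms(2,3)] by simp

lemma form_inner_add_right:
  assumes "f \<in> L2_forms p q \<Omega>" "g \<in> L2_forms p q \<Omega>" "h \<in> L2_forms p q \<Omega>"
  shows "form_inner p q \<Omega> h (f + g) = form_inner p q \<Omega> h f + form_inner p q \<Omega> h g"
  unfolding form_inner_commute[of p q \<Omega> h] form_inner_add_left[OF assms] by simp

lemma form_inner_scale_right:
  "form_inner p q \<Omega> h (form_mult (\<lambda>_. c) f) = cnj c * form_inner p q \<Omega> h f"
  unfolding form_inner_commute[of p q \<Omega> h] form_inner_scale_left by simp

lemma form_inner_self: "form_inner p q \<Omega> f f = complex_of_real ((form_norm p q \<Omega> f)\<^sup>2)"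
  unfolding form_inner_def form_norm_square of_real_sum
  by (intro sum.cong refl) (auto simp: complex_norm_square[symmetric] simp del: of_real_power)

lemma form_norm_add_square:
  assumes "f \<in> L2_forms p q \<Omega>" "g \<in> L2_forms p q \<Omega>"
  shows "(form_norm p q \<Omega> (f + g))\<^sup>2 =
    (form_norm p q \<Omega> f)\<^sup>2 + 2 * Re (form_inner p q \<Omega> f g) + (form_norm p q \<Omega> g)\<^sup>2"
proof -
  have "complex_of_real ((form_norm p q \<Omega> (f + g))\<^sup>2) =
      of_real ((form_norm p q \<Omega> f)\<^sup>2) + (form_inner p q \<Omega> f g + cnj (form_inner p q \<Omega> f g)) +
      of_real ((form_norm p q \<Omega> g)\<^sup>2)"
    unfolding form_inner_self[symmetric] form_inner_commute[of _ _ _ g f, symmetric]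
    using assms by (simp add: form_inner_add_left form_inner_add_right L2_forms_add)
  from arg_cong[OF this, of Re] show ?thesis
    by simp
qed

lemma form_norm_scale: "form_norm p q \<Omega> (form_mult (\<lambda>_. c) f) = cmod c * form_norm p q \<Omega> f"
proof -
  have "complex_of_real ((form_norm p q \<Omega> (form_mult (\<lambda>_. c) f))\<^sup>2) =
      of_real ((cmod c * form_norm p q \<Omega> f)\<^sup>2)"
    unfolding form_inner_self[symmetric] form_inner_scale_left form_inner_scale_right
    by (simp add: form_inner_self power_mult_distrib mult.commute[of "cnj c"] complex_norm_square[unfolded of_real_power])
  then have "(form_norm p q \<Omega> (form_mult (\<lambda>_. c) f))\<^sup>2 = (cmod c * form_norm p q \<Omega> f)\<^sup>2"
    by (simp only: of_real_eq_iff)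
  then show ?thesis
    by (rule power2_eq_imp_eq) auto
qed

lemma minus_eq_scale: "f - g = f + form_mult (\<lambda>_. -1) g"
  by (simp add: fun_eq_iff)

lemma form_norm_minus_commute: "form_norm p q \<Omega> (f - g) = form_norm p q \<Omega> (g - f)"
proof -
  have "f - g = form_mult (\<lambda>_. -1) (g - f)"
    by (simp add: fun_eq_iff)
  then show ?thesis
    using form_norm_scale[of p q \<Omega> "-1" "g - f"] by simp
qed

text \<open>
  If \<open>f\<close> is within \<open>e\<close> (for squared norms) of minimal among the translates of \<open>f\<close> by multiples of \<open>h\<close>,
  then \<open>f\<close> is almost orthogonal to \<open>h\<close>. This serves twice: \<open>e = \<parallel>f\<parallel>\<^sup>2\<close> is always admissible and gives
  the Cauchy--Schwarz inequality, while small \<open>e\<close> gives orthogonality in the limit along a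
  minimizing sequence. The proof moves \<open>f\<close> in the direction of \<open>h\<close> by \<open>t\<close> times the inner product;
  if \<open>h\<close> is not null the choice \<open>t = 1/\<parallel>h\<parallel>\<^sup>2\<close> is optimal.
\<close>

lemma form_inner_perturb_le:
  assumes f: "f \<in> L2_forms p q \<Omega>" and h: "h \<in> L2_forms p q \<Omega>"
    and min: "\<And>c. (form_norm p q \<Omega> f)\<^sup>2 - e \<le> (form_norm p q \<Omega> (f - form_mult (\<lambda>_. c) h))\<^sup>2"
  shows "(cmod (form_inner p q \<Omega> f h))\<^sup>2 \<le> e * (form_norm p q \<Omega> h)\<^sup>2"
proof -
  let ?a = "form_inner p q \<Omega> f h" and ?H = "(form_norm p q \<Omega> h)\<^sup>2"
  have scaled: "form_mult (\<lambda>_. c) h \<in> L2_forms p q \<Omega>" for c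
    by (rule L2_forms_mult[OF const_L_infinity h])
  have expand: "2 * t * (cmod ?a)\<^sup>2 \<le> e + t\<^sup>2 * ((cmod ?a)\<^sup>2 * ?H)" for t :: real
  proof -
    have eq: "f - form_mult (\<lambda>_. of_real t * ?a) h = f + form_mult (\<lambda>_. - of_real t * ?a) h"
      by (simp add: fun_eq_iff)
    have coeff: "Re (cnj (- of_real t * ?a) * ?a) = - t * (cmod ?a)\<^sup>2"
        "(cmod (- of_real t * ?a))\<^sup>2 = t\<^sup>2 * (cmod ?a)\<^sup>2"
      unfolding cmod_power2[of ?a]
      by (simp add: power2_eq_square algebra_simps)
        (simp add: norm_mult power_mult_distrib cmod_power2)
    have "(form_norm p q \<Omega> (f - form_mult (\<lambda>_. of_real t * ?a) h))\<^sup>2 =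
        (form_norm p q \<Omega> f)\<^sup>2 - 2 * t * (cmod ?a)\<^sup>2 + t\<^sup>2 * ((cmod ?a)\<^sup>2 * ?H)"
      unfolding eq form_norm_add_square[OF f scaled] form_inner_scale_right form_norm_scale
        power_mult_distrib coeff
      by simp
    with min[of "of_real t * ?a"] show ?thesis
      by linarith
  qed
  have "0 \<le> e"
    using expand[of 0] by simp
  show ?thesis
  proof (cases "?H = 0")
    case True
    have "(cmod ?a)\<^sup>2 \<le> 0"
    proof (rule ccontr)
      \<comment> \<open>As \<open>h\<close> is null, the quadratic term vanishes; for this \<open>t\<close> the inequality reads \<open>e + 1 \<le> e\<close>.\<close>
      assume "\<not> ?thesis"
      then show False
        using expand[of "(e + 1) / (2 * (cmod ?a)\<^sup>2)"] True by auto
    qed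
    then show ?thesis
      using True by simp
  next
    case False
    then have H: "?H > 0"
      by (simp add: less_le)
    have "(1 / ?H)\<^sup>2 * ((cmod ?a)\<^sup>2 * ?H) = (cmod ?a)\<^sup>2 / ?H"
      using False by (simp add: power2_eq_square)
    with expand[of "1 / ?H"] have "(cmod ?a)\<^sup>2 / ?H \<le> e"
      by simp
    with H show ?thesis
      by (simp add: pos_divide_le_eq)
  qed
qed

lemma form_inner_cauchy_schwarz:
  assumes "f \<in> L2_forms p q \<Omega>" "g \<in> L2_forms p q \<Omega>"
  shows "cmod (form_inner p q \<Omega> f g) \<le> form_norm p q \<Omega> f * form_norm p q \<Omega> g"
proof (rule power2_le_imp_le)
  show "(cmod (form_inner p q \<Omega> f g))\<^sup>2 \<le> (form_norm p q \<Omega> f * form_norm p q \<Omega> g)\<^sup>2"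
    unfolding power_mult_distrib by (rule form_inner_perturb_le[OF assms]) simp
qed simp

lemma form_norm_triangle:
  assumes "f \<in> L2_forms p q \<Omega>" "g \<in> L2_forms p q \<Omega>"
  shows "form_norm p q \<Omega> (f + g) \<le> form_norm p q \<Omega> f + form_norm p q \<Omega> g"
proof (rule power2_le_imp_le)
  have "Re (form_inner p q \<Omega> f g) \<le> form_norm p q \<Omega> f * form_norm p q \<Omega> g"
    using complex_Re_le_cmod form_inner_cauchy_schwarz[OF assms] by (rule order_trans)
  then show "(form_norm p q \<Omega> (f + g))\<^sup>2 \<le> (form_norm p q \<Omega> f + form_norm p q \<Omega> g)\<^sup>2"
    unfolding form_norm_add_square[OF assms] power2_sum by linarith
qed simp

lemma form_norm_zero [simp]: "form_norm p q \<Omega> 0 = 0"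
  by (simp add: form_norm_def)

lemma form_norm_sum_le:
  assumes "\<And>i. i \<in> A \<Longrightarrow> f i \<in> L2_forms p q \<Omega>"
  shows "form_norm p q \<Omega> (\<Sum>i\<in>A. f i) \<le> (\<Sum>i\<in>A. form_norm p q \<Omega> (f i))"
  using assms
proof (induction A rule: infinite_finite_induct)
  case (insert i A)
  have "form_norm p q \<Omega> (f i + (\<Sum>i\<in>A. f i)) \<le> form_norm p q \<Omega> (f i) + form_norm p q \<Omega> (\<Sum>i\<in>A. f i)"
    using insert.prems by (intro form_norm_triangle L2_forms_sum) auto
  also have "\<dots> \<le> form_norm p q \<Omega> (f i) + (\<Sum>i\<in>A. form_norm p q \<Omega> (f i))"
    using insert by simp
  finally show ?case
    unfolding sum.insert[OF insert.hyps] .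
next
  case (infinite A)
  show ?case
    unfolding sum.infinite[OF infinite(1)] form_norm_zero by simp
next
  case empty
  show ?case
    unfolding sum.empty form_norm_zero by simp
qed

lemma L2_forms_complete:
  assumes f: "\<And>n. f n \<in> L2_forms p q \<Omega>"
    and cauchy: "\<And>e. e > 0 \<Longrightarrow> \<exists>N. \<forall>m\<ge>N. \<forall>n\<ge>N. (form_norm p q \<Omega> (f m - f n))\<^sup>2 \<le> e"
  shows "\<exists>g\<in>L2_forms p q \<Omega>. (\<lambda>n. form_norm p q \<Omega> (f n - g)) \<longlonglongrightarrow> 0"
proof -
  let ?P = "\<lambda>I J v. square_integrable \<Omega> v \<and>
      (\<lambda>n. \<integral>z. (cmod (f n I J z - v z))\<^sup>2 \<partial>lebesgue_on \<Omega>) \<longlonglongrightarrow> 0"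
  have ex: "\<exists>v. ?P I J v"
    if IJ: "(I, J) \<in> multi_indices p q" for I J
  proof (rule square_integrable_complete)
    show "square_integrable \<Omega> (f n I J)" for n
      by (rule L2_forms_component[OF f IJ])
    fix e :: real assume "e > 0"
    then obtain N where N: "\<forall>m\<ge>N. \<forall>n\<ge>N. (form_norm p q \<Omega> (f m - f n))\<^sup>2 \<le> e"
      using cauchy by blast
    have "(\<integral>z. (cmod (f m I J z - f n I J z))\<^sup>2 \<partial>lebesgue_on \<Omega>) \<le> e" if "m \<ge> N" "n \<ge> N" for m n
      using order_trans[OF component_norm_le[OF IJ, of \<Omega> "f m - f n"]] N that by simp
    then show "\<exists>N. \<forall>m\<ge>N. \<forall>n\<ge>N. (\<integral>z. (cmod (f m I J z - f n I J z))\<^sup>2 \<partial>lebesgue_on \<Omega>) \<le> e"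
      by blast
  qed
  define g where "g I J = (SOME v. ?P I J v)" for I J
  have P: "?P I J (g I J)" if "(I, J) \<in> multi_indices p q" for I J
    unfolding g_def by (rule someI_ex[OF ex[OF that]])
  have "(\<lambda>n. sqrt ((form_norm p q \<Omega> (f n - g))\<^sup>2)) \<longlonglongrightarrow> sqrt 0"
    unfolding form_norm_square
    by (intro tendsto_real_sqrt tendsto_null_sum) (use P in auto)
  then have "(\<lambda>n. form_norm p q \<Omega> (f n - g)) \<longlonglongrightarrow> 0"
    by simp
  moreover have "g \<in> L2_forms p q \<Omega>"
    by (intro L2_formsI) (use P in blast)
  ultimately show ?thesis
    by blast
qed


section \<open>Closed forms and the Bergman projection\<close>

lemma Ck_one_imp:
  assumes "Ck 1 u"
  shows "u differentiable (at z)" and "continuous_on UNIV (\<lambda>z. frechet_derivative u (at z) v)"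
  using assms by (auto simp: One_nat_def)

lemma test_functionsD:
  assumes "\<psi> \<in> test_functions \<Omega>"
  shows "\<psi> differentiable (at z)" and "continuous_on UNIV (\<lambda>z. frechet_derivative \<psi> (at z) v)"
    and "compact (closure {z. \<psi> z \<noteq> 0})" and "closure {z. \<psi> z \<noteq> 0} \<subseteq> \<Omega>"
proof -
  have "Ck 1 \<psi>"
    using assms unfolding test_functions_def by blast
  from Ck_one_imp[OF this]
  show "\<psi> differentiable (at z)" and "continuous_on UNIV (\<lambda>z. frechet_derivative \<psi> (at z) v)" .
qed (use assms in \<open>auto simp: test_functions_def\<close>)

text \<open>
  Derivatives are supported in the closed support of the function. This also yields the
  differentiability of extensions by zero.
\<close>

lemma has_derivative_zero_off_closure:
  assumes "z \<notin> closure {z. u z \<noteq> 0}"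
  shows "(u has_derivative (\<lambda>_. 0)) (at z)"
proof (rule has_derivative_transform_within_open)
  show "((\<lambda>_. 0) has_derivative (\<lambda>_. 0)) (at z)"
    by (rule has_derivative_const)
  show "open (- closure {z. u z \<noteq> 0})" and "z \<in> - closure {z. u z \<noteq> 0}"
    using assms by auto
  fix x assume "x \<in> - closure {z. u z \<noteq> 0}"
  then show "0 = u x"
    using closure_subset[of "{z. u z \<noteq> 0}"] by auto
qed

lemma wirtinger_bar_zero_off_support:
  "z \<notin> closure {z. \<psi> z \<noteq> 0} \<Longrightarrow> wirtinger_bar k \<psi> z = 0"
  using frechet_derivative_at[OF has_derivative_zero_off_closure, of z \<psi>, symmetric]
  by (simp add: wirtinger_bar_def)

lemma continuous_wirtinger_bar:
  "\<psi> \<in> test_functions \<Omega> \<Longrightarrow> continuous_on UNIV (wirtinger_bar k \<psi>)"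
  unfolding wirtinger_bar_def by (intro continuous_intros test_functionsD(2)) auto

lemma integrable_bounded_on_compact:
  fixes f :: "'a::euclidean_space \<Rightarrow> 'b::{banach, second_countable_topology}"
  assumes [measurable]: "f \<in> borel_measurable lborel" and "compact S"
    and bound: "\<And>z. z \<in> S \<Longrightarrow> norm (f z) \<le> B" and zero: "\<And>z. z \<notin> S \<Longrightarrow> f z = 0"
  shows "integrable lborel f"
proof (rule Bochner_Integration.integrable_bound)
  have "integrable lborel (indicat_real S)"
    using emeasure_bounded_finite[OF compact_imp_bounded[OF \<open>compact S\<close>]] compact_imp_closed[OF \<open>compact S\<close>]
    by (intro integrable_real_indicator) auto
  then show "integrable lborel (\<lambda>z. B * indicat_real S z)"
    by (rule integrable_mult_right)
  show "AE z in lborel. norm (f z) \<le> norm (B * indicat_real S z)"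
  proof (rule AE_I2)
    fix z
    show "norm (f z) \<le> norm (B * indicat_real S z)"
      using bound[of z] zero[of z] by (cases "z \<in> S") (auto intro: order_trans[OF _ abs_ge_self])
  qed
qed measurable

lemma square_integrable_wirtinger_bar:
  assumes "open \<Omega>" "\<psi> \<in> test_functions \<Omega>"
  shows "square_integrable \<Omega> (wirtinger_bar k \<psi>)"
proof -
  let ?S = "closure {z. \<psi> z \<noteq> 0}" and ?w = "wirtinger_bar k \<psi>"
  have [measurable]: "?w \<in> borel_measurable borel"
    by (intro borel_measurable_continuous_onI continuous_wirtinger_bar[OF assms(2)])
  have "continuous_on ?S (\<lambda>z. (cmod (?w z))\<^sup>2)"
    by (intro continuous_intros continuous_on_subset[OF continuous_wirtinger_bar[OF assms(2)]]) auto
  then have "bounded ((\<lambda>z. (cmod (?w z))\<^sup>2) ` ?S)"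
    by (intro compact_imp_bounded compact_continuous_image test_functionsD(3)[OF assms(2)])
  then obtain B where "\<And>z. z \<in> ?S \<Longrightarrow> norm ((cmod (?w z))\<^sup>2) \<le> B"
    by (auto simp: bounded_iff)
  then have "integrable lborel (\<lambda>z. (cmod (?w z))\<^sup>2)"
    using test_functionsD(3)[OF assms(2)] wirtinger_bar_zero_off_support[of _ \<psi> k]
    by (intro integrable_bounded_on_compact[of _ ?S B]) auto
  then have "integrable lebesgue (\<lambda>z. (cmod (?w z))\<^sup>2)"
    by (simp add: integrable_completion)
  then have "integrable (lebesgue_on \<Omega>) (\<lambda>z. (cmod (?w z))\<^sup>2)"
    using assms(1) by (subst integrable_restrict_space, simp) (intro integrable_mult_indicator, simp_all)
  moreover have "?w \<in> borel_measurable (lebesgue_on \<Omega>)"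
    by (intro measurable_restrict_space1 measurable_completion) simp
  ultimately show ?thesis
    by (simp add: square_integrable_def)
qed

definition dbar_sign :: "nat \<Rightarrow> 'n::linorder \<Rightarrow> 'n set \<Rightarrow> complex" where
  "dbar_sign p k M = (-1) ^ (p + card {j\<in>M. j < k})"

text \<open>
  The form that represents \<open>f \<mapsto> dbar p \<Omega> f I M \<psi>\<close> as an inner product: the formal adjoint of \<open>dbar\<close>
  applied to \<open>cnj \<psi>\<close> in the component \<open>(I, M)\<close>.
\<close>

definition dbar_test_form ::
    "nat \<Rightarrow> 'n set \<Rightarrow> 'n set \<Rightarrow> ('n cvec \<Rightarrow> complex) \<Rightarrow> 'n::{finite,linorder} form" where
  "dbar_test_form p I M \<psi> = (\<lambda>I' J z.
     \<Sum>k\<in>M. (if I' = I \<and> J = M - {k} then - dbar_sign p k M else 0) * cnj (wirtinger_bar k \<psi> z))"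

lemma cnj_dbar_sign [simp]: "cnj (dbar_sign p k M) = dbar_sign p k M"
  by (simp add: dbar_sign_def)

lemma dbar_sign_square: "dbar_sign p k M * dbar_sign p k M = 1"
  by (simp add: dbar_sign_def flip: power_mult_distrib)

lemma L2_forms_dbar_test_form:
  assumes "open \<Omega>" "\<psi> \<in> test_functions \<Omega>"
  shows "dbar_test_form p I M \<psi> \<in> L2_forms p q \<Omega>"
  unfolding dbar_test_form_def
  by (intro L2_formsI square_integrable_sum square_integrable_scale square_integrable_cnj
      square_integrable_wirtinger_bar assms)

lemma multi_indices_remove:
  "(I, M) \<in> multi_indices p (q + 1) \<Longrightarrow> k \<in> M \<Longrightarrow> (I, M - {k}) \<in> multi_indices p q"
  by (auto simp: multi_indices_def)

text \<open>
  The distributional \<open>dbar\<close> of a square integrable form, tested against a fixed function, is a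
  bounded linear functional. So the closed forms are the orthogonal complement of the forms
  \<open>dbar_test_form p I M \<psi>\<close>, and all closure properties below are inherited from the inner product.
\<close>

lemma dbar_eq_form_inner:
  fixes \<Omega> :: "'n::{finite,linorder} cvec set"
  assumes "open \<Omega>" "f \<in> L2_forms p q \<Omega>" "\<psi> \<in> test_functions \<Omega>" "(I, M) \<in> multi_indices p (q + 1)"
  shows "dbar p \<Omega> f I M \<psi> = form_inner p q \<Omega> f (dbar_test_form p I M \<psi>)"
proof -
  let ?c = "\<lambda>k (I' :: 'n set) (J :: 'n set). if I' = I \<and> J = M - {k} then - dbar_sign p k M else 0"
  let ?D = "\<lambda>k I' J. \<integral>z. f I' J z * wirtinger_bar k \<psi> z \<partial>lebesgue_on \<Omega>"
  have "form_inner p q \<Omega> f (dbar_test_form p I M \<psi>) =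
      (\<Sum>(I', J)\<in>multi_indices p q. \<Sum>k\<in>M. ?c k I' J * ?D k I' J)"
    unfolding form_inner_def
  proof (intro sum.cong refl, clarify)
    fix I' J :: "'n set" assume IJ: "(I', J) \<in> multi_indices p q"
    have int: "integrable (lebesgue_on \<Omega>) (\<lambda>z. f I' J z * wirtinger_bar k \<psi> z)" for k
      by (intro integrable_mult_square_integrable L2_forms_component[OF assms(2) IJ]
          square_integrable_wirtinger_bar assms)
    have "f I' J z * cnj (dbar_test_form p I M \<psi> I' J z) =
        (\<Sum>k\<in>M. ?c k I' J * (f I' J z * wirtinger_bar k \<psi> z))" for z
      unfolding dbar_test_form_def cnj_sum sum_distrib_left by (intro sum.cong) auto
    then show "(\<integral>z. f I' J z * cnj (dbar_test_form p I M \<psi> I' J z) \<partial>lebesgue_on \<Omega>) =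
        (\<Sum>k\<in>M. ?c k I' J * ?D k I' J)"
      by (simp only: Bochner_Integration.integral_sum integrable_mult_right int integral_mult_right_zero)
  qed
  also have "\<dots> = (\<Sum>k\<in>M. \<Sum>(I', J)\<in>multi_indices p q. ?c k I' J * ?D k I' J)"
    by (subst sum.swap) (simp add: case_prod_unfold)
  also have "\<dots> = (\<Sum>k\<in>M. - dbar_sign p k M * ?D k I (M - {k}))"
  proof (intro sum.cong refl)
    fix k assume "k \<in> M"
    have "(\<Sum>(I', J)\<in>multi_indices p q. ?c k I' J * ?D k I' J) =
        (\<Sum>x\<in>multi_indices p q. if x = (I, M - {k}) then - dbar_sign p k M * ?D k I (M - {k}) else 0)"
      by (intro sum.cong) (auto split: if_splits)
    also have "\<dots> = - dbar_sign p k M * ?D k I (M - {k})"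
      using multi_indices_remove[OF assms(4) \<open>k \<in> M\<close>] by simp
    finally show "(\<Sum>(I', J)\<in>multi_indices p q. ?c k I' J * ?D k I' J) =
      - dbar_sign p k M * ?D k I (M - {k})" .
  qed
  also have "\<dots> = dbar p \<Omega> f I M \<psi>"
    by (simp add: dbar_def dbar_sign_def distr_wirtinger_bar_def)
  finally show ?thesis ..
qed

lemma K2_forms_iff:
  assumes "open \<Omega>"
  shows "f \<in> K2_forms p q \<Omega> \<longleftrightarrow> f \<in> L2_forms p q \<Omega> \<and>
    (\<forall>I M \<psi>. (I, M) \<in> multi_indices p (q + 1) \<longrightarrow> \<psi> \<in> test_functions \<Omega> \<longrightarrow>
       form_inner p q \<Omega> f (dbar_test_form p I M \<psi>) = 0)"
  unfolding K2_forms_def using dbar_eq_form_inner[OF assms] by fastforce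

lemma K2_forms_L2: "f \<in> K2_forms p q \<Omega> \<Longrightarrow> f \<in> L2_forms p q \<Omega>"
  by (simp add: K2_forms_def)

lemma K2_forms_zero: "open \<Omega> \<Longrightarrow> 0 \<in> K2_forms p q \<Omega>"
  by (simp add: K2_forms_iff L2_forms_zero form_inner_def)

lemma K2_forms_add:
  assumes "open \<Omega>" "f \<in> K2_forms p q \<Omega>" "g \<in> K2_forms p q \<Omega>"
  shows "f + g \<in> K2_forms p q \<Omega>"
  using assms by (auto simp: K2_forms_iff L2_forms_add form_inner_add_left L2_forms_dbar_test_form)

lemma K2_forms_diff:
  assumes "open \<Omega>" "f \<in> K2_forms p q \<Omega>" "g \<in> K2_forms p q \<Omega>"
  shows "f - g \<in> K2_forms p q \<Omega>"
  using assms by (auto simp: K2_forms_iff L2_forms_diff form_inner_diff_left L2_forms_dbar_test_form)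

lemma K2_forms_scale:
  assumes "open \<Omega>" "f \<in> K2_forms p q \<Omega>"
  shows "form_mult (\<lambda>_. c) f \<in> K2_forms p q \<Omega>"
  using assms by (auto simp: K2_forms_iff L2_forms_mult const_L_infinity form_inner_scale_left)

lemma K2_forms_sum:
  assumes "open \<Omega>" "\<And>i. i \<in> A \<Longrightarrow> f i \<in> K2_forms p q \<Omega>"
  shows "(\<Sum>i\<in>A. f i) \<in> K2_forms p q \<Omega>"
  using assms(2)
  by (induction A rule: infinite_finite_induct) (auto intro: K2_forms_zero K2_forms_add assms(1))

lemma K2_forms_closed:
  fixes \<Omega> :: "'n::{finite,linorder} cvec set"
  assumes "open \<Omega>" and f: "\<And>n. f n \<in> K2_forms p q \<Omega>" and g: "g \<in> L2_forms p q \<Omega>"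
    and lim: "(\<lambda>n. form_norm p q \<Omega> (f n - g)) \<longlonglongrightarrow> 0"
  shows "g \<in> K2_forms p q \<Omega>"
  unfolding K2_forms_iff[OF \<open>open \<Omega>\<close>]
proof (intro conjI g, clarify)
  fix I M :: "'n set" and \<psi> assume IM: "(I, M) \<in> multi_indices p (q + 1)" and \<psi>: "\<psi> \<in> test_functions \<Omega>"
  let ?w = "dbar_test_form p I M \<psi>"
  have w: "?w \<in> L2_forms p q \<Omega>"
    by (rule L2_forms_dbar_test_form[OF \<open>open \<Omega>\<close> \<psi>])
  have "cmod (form_inner p q \<Omega> g ?w) \<le> form_norm p q \<Omega> (f n - g) * form_norm p q \<Omega> ?w" for n
  proof -
    have "form_inner p q \<Omega> (f n - g) ?w = - form_inner p q \<Omega> g ?w"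
      using f[of n] IM \<psi> K2_forms_L2[OF f] g w
      by (auto simp: K2_forms_iff[OF \<open>open \<Omega>\<close>] form_inner_diff_left)
    then show ?thesis
      using form_inner_cauchy_schwarz[OF L2_forms_diff[OF K2_forms_L2[OF f] g] w, of n] by simp
  qed
  moreover have "(\<lambda>n. form_norm p q \<Omega> (f n - g) * form_norm p q \<Omega> ?w) \<longlonglongrightarrow> 0"
    using tendsto_mult_right[OF lim] by simp
  ultimately have "cmod (form_inner p q \<Omega> g ?w) \<le> 0"
    by (intro LIMSEQ_le_const) auto
  then show "form_inner p q \<Omega> g ?w = 0"
    by simp
qed

lemma form_norm_parallelogram:
  assumes "f \<in> L2_forms p q \<Omega>" "g \<in> L2_forms p q \<Omega>"
  shows "(form_norm p q \<Omega> (f + g))\<^sup>2 + (form_norm p q \<Omega> (f - g))\<^sup>2 =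
    2 * (form_norm p q \<Omega> f)\<^sup>2 + 2 * (form_norm p q \<Omega> g)\<^sup>2"
  using form_norm_add_square[OF assms]
    form_norm_add_square[OF assms(1) L2_forms_mult[OF const_L_infinity assms(2)], of "-1"]
  unfolding minus_eq_scale form_norm_scale form_inner_scale_right by simp

text \<open>
  The projection theorem. A sequence of closed forms whose distance to \<open>f\<close> tends to the infimum is
  Cauchy by the parallelogram identity, since the midpoints are closed forms as well; its limit is
  closed, and the almost minimality of its members forces orthogonality.
\<close>

lemma K2_projection_exists:
  assumes "open \<Omega>" and f: "f \<in> L2_forms p q \<Omega>"
  shows "\<exists>g\<in>K2_forms p q \<Omega>. \<forall>h\<in>K2_forms p q \<Omega>. form_inner p q \<Omega> (f - g) h = 0"
proof -
  let ?K = "K2_forms p q \<Omega>" and ?N = "\<lambda>f. (form_norm p q \<Omega> f)\<^sup>2"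
  note K2L = K2_forms_L2[where p = p and q = q and \<Omega> = \<Omega>]
  define d where "d = Inf ((\<lambda>h. ?N (f - h)) ` ?K)"
  have d_le: "d \<le> ?N (f - h)" if "h \<in> ?K" for h
    unfolding d_def using that by (intro cInf_lower) (auto intro!: bdd_belowI[of _ 0])
  have "\<exists>h\<in>?K. ?N (f - h) < d + 1 / Suc n" for n
    using cInf_lessD[of "(\<lambda>h. ?N (f - h)) ` ?K" "d + 1 / Suc n"] K2_forms_zero[OF \<open>open \<Omega>\<close>]
    unfolding d_def by auto
  then obtain h where h: "\<And>n. h n \<in> ?K" and h_less: "\<And>n. ?N (f - h n) < d + 1 / Suc n"
    by metis
  have dist: "?N (h m - h n) \<le> 2 * (1 / Suc m + 1 / Suc n)" for m n
  proof -
    have "(f - h n) - (f - h m) = h m - h n"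
      by (simp add: fun_eq_iff)
    \<comment> \<open>The sum is twice the difference of \<open>f\<close> and the midpoint, whose squared norm is at least \<open>d\<close>.\<close>
    moreover have "(f - h n) + (f - h m) = form_mult (\<lambda>_. 2) (f - form_mult (\<lambda>_. 1/2) (h n + h m))"
      by (simp add: fun_eq_iff algebra_simps)
    ultimately have "4 * ?N (f - form_mult (\<lambda>_. 1/2) (h n + h m)) + ?N (h m - h n) =
        2 * ?N (f - h n) + 2 * ?N (f - h m)"
      using form_norm_parallelogram[of "f - h n" p q \<Omega> "f - h m"] f K2L[OF h]
      by (simp add: L2_forms_diff form_norm_scale power_mult_distrib)
    moreover have "d \<le> ?N (f - form_mult (\<lambda>_. 1/2) (h n + h m))"
      by (intro d_le K2_forms_scale K2_forms_add h \<open>open \<Omega>\<close>)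
    ultimately show ?thesis
      using h_less[of n] h_less[of m] by (simp add: distrib_left)
  qed
  have "\<exists>N. \<forall>m\<ge>N. \<forall>n\<ge>N. ?N (h m - h n) \<le> e" if "e > 0" for e :: real
  proof -
    have "e / 4 > 0"
      using that by simp
    then obtain N where N: "1 / real (Suc N) < e / 4"
      using reals_Archimedean[of "e / 4"] unfolding inverse_eq_divide by blast
    have small: "1 / real (Suc n) < e / 4" if "n \<ge> N" for n
      using that by (intro le_less_trans[OF _ N]) (auto simp: field_simps)
    then have "?N (h m - h n) \<le> e" if "m \<ge> N" "n \<ge> N" for m n
      using dist[of m n] add_strict_mono[OF small[OF that(1)] small[OF that(2)]] by argo
    then show ?thesis
      by blast
  qed
  from L2_forms_complete[OF K2L[OF h] this]
  obtain g where g: "g \<in> L2_forms p q \<Omega>" and lim: "(\<lambda>n. form_norm p q \<Omega> (h n - g)) \<longlonglongrightarrow> 0"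
    by blast
  have "g \<in> ?K"
    by (rule K2_forms_closed[OF \<open>open \<Omega>\<close> h g lim])
  moreover have "form_inner p q \<Omega> (f - g) k = 0" if k: "k \<in> ?K" for k
  proof -
    have fh: "f - h n \<in> L2_forms p q \<Omega>" for n
      by (intro L2_forms_diff f K2L h)
    have hg: "h n - g \<in> L2_forms p q \<Omega>" for n
      by (intro L2_forms_diff g K2L h)
    have "cmod (form_inner p q \<Omega> (f - g) k) \<le>
        sqrt (1 / Suc n) * form_norm p q \<Omega> k + form_norm p q \<Omega> (h n - g) * form_norm p q \<Omega> k" for n
    proof -
      have "?N (f - h n) - 1 / Suc n \<le> ?N (f - h n - form_mult (\<lambda>_. c) k)" for c
        using h_less[of n] d_le[OF K2_forms_add[OF \<open>open \<Omega>\<close> h K2_forms_scale[OF \<open>open \<Omega>\<close> k]], of n c]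
        by (simp add: diff_diff_eq)
      from form_inner_perturb_le[OF fh K2L[OF k] this]
      have "(cmod (form_inner p q \<Omega> (f - h n) k))\<^sup>2 \<le> (sqrt (1 / Suc n) * form_norm p q \<Omega> k)\<^sup>2"
        by (simp add: power_mult_distrib)
      then have near: "cmod (form_inner p q \<Omega> (f - h n) k) \<le> sqrt (1 / Suc n) * form_norm p q \<Omega> k"
        by (rule power2_le_imp_le) simp
      have split: "form_inner p q \<Omega> (f - g) k =
          form_inner p q \<Omega> (f - h n) k + form_inner p q \<Omega> (h n - g) k"
        using form_inner_add_left[OF fh hg K2L[OF k], of n n] by simp
      show ?thesis
        unfolding split
        by (rule order_trans[OF norm_triangle_ineq
              add_mono[OF near form_inner_cauchy_schwarz[OF hg K2L[OF k]]]])
    qed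
    moreover have "(\<lambda>n. sqrt (1 / Suc n) * form_norm p q \<Omega> k +
        form_norm p q \<Omega> (h n - g) * form_norm p q \<Omega> k) \<longlonglongrightarrow>
        sqrt 0 * form_norm p q \<Omega> k + 0 * form_norm p q \<Omega> k"
      by (intro tendsto_intros lim LIMSEQ_Suc[OF lim_1_over_n, unfolded o_def])
    ultimately have "cmod (form_inner p q \<Omega> (f - g) k) \<le> 0"
      by (intro LIMSEQ_le_const) auto
    then show ?thesis
      by simp
  qed
  ultimately show ?thesis
    by blast
qed

lemma bergman_proj:
  assumes "open \<Omega>" "f \<in> L2_forms p q \<Omega>"
  shows "bergman_proj p q \<Omega> f \<in> K2_forms p q \<Omega>"
    and "h \<in> K2_forms p q \<Omega> \<Longrightarrow> form_inner p q \<Omega> (f - bergman_proj p q \<Omega> f) h = 0"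
  using someI_ex[OF K2_projection_exists[OF assms, unfolded Bex_def]]
  unfolding bergman_proj_def form_diff_eq_minus by auto

text \<open>
  Pythagoras: removing an orthogonal part does not increase the norm. It is stated for any \<open>g\<close>
  orthogonal to \<open>f - g\<close>, because it is applied to a representative of the projection other than
  the value chosen by \<open>bergman_proj\<close>.
\<close>

lemma form_norm_residual_le:
  assumes "f \<in> L2_forms p q \<Omega>" "g \<in> L2_forms p q \<Omega>" and orth: "form_inner p q \<Omega> (f - g) g = 0"
  shows "form_norm p q \<Omega> (f - g) \<le> form_norm p q \<Omega> f"
proof (rule power2_le_imp_le)
  show "(form_norm p q \<Omega> (f - g))\<^sup>2 \<le> (form_norm p q \<Omega> f)\<^sup>2"
    using form_norm_add_square[OF L2_forms_diff[OF assms(1,2)] assms(2)] orth by simp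
qed simp

lemma bergman_proj_fixes_K2:
  assumes "open \<Omega>" "f \<in> K2_forms p q \<Omega>"
  shows "form_norm p q \<Omega> (f - bergman_proj p q \<Omega> f) = 0"
proof -
  have "form_inner p q \<Omega> (f - bergman_proj p q \<Omega> f) (f - bergman_proj p q \<Omega> f) = 0"
    using bergman_proj[OF \<open>open \<Omega>\<close> K2_forms_L2[OF assms(2)]] assms by (simp add: K2_forms_diff)
  then show ?thesis
    by (simp add: form_inner_self)
qed


section \<open>Holomorphic coefficients give closed forms\<close>

lemma norm_axis: "norm (axis k x :: complex ^ 'n) = cmod x"
  by (simp add: norm_eq_sqrt_inner inner_axis_axis)

lemma scalar_mult_axis: "c *s (axis k x :: complex ^ 'n) = axis k (c * x)"
  by (simp add: vec_eq_iff axis_def)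

lemma lborel_integral_translate:
  fixes f :: "'a::euclidean_space \<Rightarrow> 'b::{banach, second_countable_topology}"
  assumes [measurable]: "f \<in> borel_measurable borel"
  shows "(\<integral>x. f (x + a) \<partial>lborel) = (\<integral>x. f x \<partial>lborel)"
    and "integrable lborel f \<Longrightarrow> integrable lborel (\<lambda>x. f (x + a))"
proof -
  have "(\<integral>x. f x \<partial>distr lborel borel ((+) a)) = (\<integral>x. f (a + x) \<partial>lborel)"
    by (rule integral_distr) auto
  then show "(\<integral>x. f (x + a) \<partial>lborel) = (\<integral>x. f x \<partial>lborel)"
    by (simp add: lborel_distr_plus add.commute)
  have "integrable (distr lborel borel ((+) a)) f \<longleftrightarrow> integrable lborel (\<lambda>x. f (a + x))"
    by (rule integrable_distr_eq) auto
  then show "integrable lborel f \<Longrightarrow> integrable lborel (\<lambda>x. f (x + a))"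
    by (simp add: lborel_distr_plus add.commute)
qed

lemma directional_has_vector_derivative:
  fixes w :: "'a::real_normed_vector \<Rightarrow> 'b::real_normed_vector"
  assumes "(w has_derivative D) (at (z + t *\<^sub>R v))"
  shows "((\<lambda>t. w (z + t *\<^sub>R v)) has_vector_derivative D v) (at t)"
proof -
  have "((\<lambda>t. z + t *\<^sub>R v) has_derivative (\<lambda>h. h *\<^sub>R v)) (at t)"
    by (auto intro!: derivative_eq_intros)
  from has_derivative_compose[OF this assms]
  have "((\<lambda>t. w (z + t *\<^sub>R v)) has_derivative (\<lambda>h. D (h *\<^sub>R v))) (at t)" .
  then show ?thesis
    unfolding has_vector_derivative_def
    using linear_scale[OF has_derivative_linear[OF assms], of _ v] by simp
qed

lemma norm_increment_le:
  fixes w :: "'a::real_normed_vector \<Rightarrow> 'b::real_normed_vector"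
  assumes D: "\<And>z. (w has_derivative D z) (at z)" and bound: "\<And>z. norm (D z v) \<le> B"
  shows "norm (w (z + t *\<^sub>R v) - w z) \<le> B * \<bar>t\<bar>"
proof -
  have "norm (w (z + t *\<^sub>R v) - w (z + 0 *\<^sub>R v)) \<le> B * norm (t - 0)"
  proof (rule differentiable_bound[where S = UNIV])
    fix s :: real
    show "((\<lambda>t. w (z + t *\<^sub>R v)) has_derivative (\<lambda>h. h *\<^sub>R D (z + s *\<^sub>R v) v)) (at s within UNIV)"
      using directional_has_vector_derivative[OF D] by (simp add: has_vector_derivative_def)
    show "onorm (\<lambda>h. h *\<^sub>R D (z + s *\<^sub>R v) v) \<le> B"
      using mult_right_mono[OF bound abs_ge_zero] by (intro onorm_le) (simp add: mult.commute[of "\<bar>_\<bar>"])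
  qed auto
  then show ?thesis
    by simp
qed

text \<open>
  Integration by parts without Fubini: by translation invariance, all difference quotients of \<open>w\<close> in
  the direction \<open>v\<close> have integral zero. The bound on the directional derivative makes them uniformly
  bounded, and they are supported in a common compact set, so dominated convergence applies. The
  derivative need not be continuous, which matters because the holomorphic functions here are only
  assumed to be differentiable.
\<close>

lemma integral_directional_derivative_zero:
  fixes w :: "'a::euclidean_space \<Rightarrow> 'b::{banach, second_countable_topology}"
  assumes D: "\<And>z. (w has_derivative D z) (at z)" and bound: "\<And>z. norm (D z v) \<le> B"
    and "compact S" and zero: "\<And>z. z \<notin> S \<Longrightarrow> w z = 0"
  shows "integrable lborel (\<lambda>z. D z v)" and "(\<integral>z. D z v \<partial>lborel) = 0"
proof -
  have cont: "continuous_on UNIV w"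
    by (meson D continuous_at_imp_continuous_on has_derivative_continuous)
  then have [measurable]: "w \<in> borel_measurable borel"
    by (rule borel_measurable_continuous_onI)
  have "bounded (w ` S)"
    by (intro compact_imp_bounded compact_continuous_image \<open>compact S\<close> continuous_on_subset[OF cont]) auto
  then obtain C where "\<And>z. z \<in> S \<Longrightarrow> norm (w z) \<le> C"
    by (auto simp: bounded_iff)
  then have int_w: "integrable lborel w"
    by (intro integrable_bounded_on_compact[OF _ \<open>compact S\<close> _ zero]) auto
  let ?t = "\<lambda>n. 1 / real (Suc n)"
  define s where "s n z = real (Suc n) *\<^sub>R (w (z + ?t n *\<^sub>R v) - w z)" for n z
  \<comment> \<open>The points from which some step \<open>t *\<^sub>R v\<close> with \<open>0 \<le> t \<le> 1\<close> leads into \<open>S\<close>.\<close>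
  define S' where "S' = {x + y |x y. x \<in> S \<and> y \<in> (\<lambda>t. t *\<^sub>R v) ` {-1..0}}"
  have "compact S'"
    unfolding S'_def
    by (intro compact_sums \<open>compact S\<close> compact_continuous_image continuous_intros compact_Icc)
  have s_zero: "s n z = 0" if "z \<notin> S'" for n z
  proof -
    have "z + t *\<^sub>R v \<notin> S" if "0 \<le> t" "t \<le> 1" for t
    proof
      assume "z + t *\<^sub>R v \<in> S"
      then have "(z + t *\<^sub>R v) + (-t) *\<^sub>R v \<in> S'"
        unfolding S'_def using that
        by (intro CollectI exI[of _ "z + t *\<^sub>R v"] exI[of _ "(-t) *\<^sub>R v"] conjI refl imageI) auto
      with \<open>z \<notin> S'\<close> show False
        by simp
    qed
    from this[of 0] this[of "?t n"] show ?thesis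
      by (simp add: s_def zero)
  qed
  have s_bound: "norm (s n z) \<le> B * indicat_real S' z" for n z
  proof (cases "z \<in> S'")
    case True
    have "norm (s n z) = real (Suc n) * norm (w (z + ?t n *\<^sub>R v) - w z)"
      by (simp add: s_def)
    also have "\<dots> \<le> real (Suc n) * (B * \<bar>?t n\<bar>)"
      by (intro mult_left_mono norm_increment_le[OF D bound]) auto
    also have "\<dots> = B"
      by (simp add: abs_of_nonneg)
    finally show ?thesis
      using True by simp
  qed (simp add: s_zero)
  have s_lim: "(\<lambda>n. s n z) \<longlonglongrightarrow> D z v" for z
  proof -
    have "((\<lambda>t. w (z + t *\<^sub>R v)) has_vector_derivative D z v) (at 0)"
      by (rule directional_has_vector_derivative) (simp add: D)
    then have "((\<lambda>t. norm (w (z + t *\<^sub>R v) - w z - t *\<^sub>R D z v) / norm t) \<longlongrightarrow> 0) (at 0)"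
      by (simp add: has_vector_derivative_def has_derivative_at)
    moreover have "norm (w (z + t *\<^sub>R v) - w z - t *\<^sub>R D z v) / norm t =
        norm ((1 / t) *\<^sub>R (w (z + t *\<^sub>R v) - w z) - D z v)" if "t \<noteq> 0" for t
    proof -
      have "(1 / t) *\<^sub>R (w (z + t *\<^sub>R v) - w z) - D z v =
          (1 / t) *\<^sub>R (w (z + t *\<^sub>R v) - w z - t *\<^sub>R D z v)"
        using that by (simp add: scaleR_diff_right)
      then show ?thesis
        by simp
    qed
    ultimately have "((\<lambda>t. norm ((1 / t) *\<^sub>R (w (z + t *\<^sub>R v) - w z) - D z v)) \<longlongrightarrow> 0) (at 0)"
      by (elim Lim_transform_eventually) (auto simp: eventually_at_filter)
    then have lim0: "((\<lambda>t. (1 / t) *\<^sub>R (w (z + t *\<^sub>R v) - w z)) \<longlongrightarrow> D z v) (at 0)"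
      by (simp only: tendsto_norm_zero_iff LIM_zero_iff)
    have "filterlim ?t (at 0) sequentially"
      unfolding filterlim_at using LIMSEQ_Suc[OF lim_1_over_n] by simp
    from filterlim_compose[OF lim0 this] show ?thesis
      by (simp add: s_def)
  qed
  have [measurable]: "s n \<in> borel_measurable borel" for n
    unfolding s_def by measurable
  have [measurable]: "(\<lambda>z. D z v) \<in> borel_measurable borel"
    by (rule borel_measurable_LIMSEQ_metric[OF _ s_lim]) measurable
  have "integrable lborel (\<lambda>z. indicat_real S' z *\<^sub>R B)"
    using \<open>compact S'\<close> compact_imp_closed[OF \<open>compact S'\<close>]
    by (intro integrable_bounded_on_compact[OF _ \<open>compact S'\<close>, of _ "\<bar>B\<bar>"]) auto
  then have dom: "integrable lborel (\<lambda>z. B * indicat_real S' z)"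
    by (simp add: mult.commute)
  show "integrable lborel (\<lambda>z. D z v)"
    by (rule integrable_dominated_convergence[OF _ _ dom, of _ s]) (auto simp: s_lim s_bound)
  have "(\<lambda>n. integral\<^sup>L lborel (s n)) \<longlonglongrightarrow> (\<integral>z. D z v \<partial>lborel)"
    by (rule integral_dominated_convergence[OF _ _ dom]) (auto simp: s_lim s_bound)
  moreover have "integral\<^sup>L lborel (s n) = 0" for n
    unfolding s_def using lborel_integral_translate[of w] int_w by simp
  ultimately show "(\<integral>z. D z v \<partial>lborel) = 0"
    by (simp add: LIMSEQ_const_iff)
qed

text \<open>
  The restriction of \<open>u\<close> to the complex line through \<open>z\<close> in the direction of the \<open>k\<close>-th coordinate is
  a holomorphic function of one variable on the disc of radius \<open>r\<close>.
\<close>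

lemma holomorphic_Cn_cauchy_estimate:
  assumes hol: "holomorphic_Cn \<Omega> u" and "r > 0" and sub: "cball z r \<subseteq> \<Omega>"
    and bound: "\<And>x. x \<in> cball z r \<Longrightarrow> cmod (u x) \<le> M"
    and D: "(u has_derivative D) (at z)"
  shows "cmod (D (axis k 1)) \<le> M / r"
proof -
  let ?l = "\<lambda>\<zeta>. z + axis k \<zeta>" and ?g = "\<lambda>\<zeta>. u (z + axis k \<zeta>)"
  have in_ball: "?l \<zeta> \<in> cball z r" if "\<zeta> \<in> cball 0 r" for \<zeta>
    using that by (simp add: dist_norm norm_axis)
  have lin: "bounded_linear (axis k :: complex \<Rightarrow> complex ^ 'a)"
    by (rule bounded_linear_intro[where K = 1]; (simp add: norm_axis)?; simp add: vec_eq_iff axis_def)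
  have deriv: "(?g has_field_derivative E (axis k 1)) (at \<zeta>)"
    if E: "(u has_derivative E) (at (?l \<zeta>))" "\<forall>c v. E (c *s v) = c * E v" for \<zeta> E
  proof -
    have "(?l has_derivative axis k) (at \<zeta>)"
      by (rule has_derivative_eq_rhs[OF has_derivative_add[OF has_derivative_const
            bounded_linear_imp_has_derivative[OF lin]]]) simp
    from has_derivative_compose[OF this E(1)]
    have "(?g has_derivative (\<lambda>h. E (axis k h))) (at \<zeta>)" .
    moreover have "(\<lambda>h. E (axis k h)) = (*) (E (axis k 1))"
    proof
      show "E (axis k h) = E (axis k 1) * h" for h
        using E(2)[rule_format, of h "axis k 1"] by (simp add: scalar_mult_axis mult.commute)
    qed
    ultimately show ?thesis
      unfolding has_field_derivative_def by (simp only:)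
  qed
  have diff: "?g field_differentiable (at \<zeta>)" if "\<zeta> \<in> cball 0 r" for \<zeta>
    using hol in_ball[OF that] sub deriv unfolding holomorphic_Cn_def field_differentiable_def by blast
  have hol_g: "?g holomorphic_on cball 0 r"
    unfolding holomorphic_on_def using diff field_differentiable_at_within by blast
  have "cmod ((deriv ^^ 1) ?g 0) \<le> fact 1 * M / r ^ 1"
  proof (rule Cauchy_inequality[OF _ _ \<open>r > 0\<close>])
    show "?g holomorphic_on ball 0 r"
      by (rule holomorphic_on_subset[OF hol_g]) auto
    show "continuous_on (cball 0 r) ?g"
      by (rule holomorphic_on_imp_continuous_on[OF hol_g])
    show "cmod (?g x) \<le> M" if "cmod (0 - x) = r" for x
      using that by (intro bound in_ball) (simp add: dist_norm)
  qed
  moreover have "deriv ?g 0 = D (axis k 1)"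
  proof -
    have "z \<in> \<Omega>"
      using sub \<open>r > 0\<close> by auto
    then obtain E where E: "(u has_derivative E) (at z)" "\<forall>c v. E (c *s v) = c * E v"
      using hol unfolding holomorphic_Cn_def by blast
    have "E = D"
      by (rule has_derivative_unique[OF E(1) D])
    moreover have "axis k 0 = (0 :: complex ^ 'a)"
      by simp
    ultimately show ?thesis
      using DERIV_imp_deriv[OF deriv[of D 0]] E by (metis add.right_neutral)
  qed
  ultimately show ?thesis
    by simp
qed

text \<open>
  The product \<open>w = u \<psi>\<close>, extended by zero, is differentiable on the whole space and compactly
  supported, so its directional derivatives integrate to zero. The complex linearity of the
  derivative \<open>U\<close> of \<open>u\<close> makes the contributions of \<open>U\<close> to
  \<open>(\<partial>/\<partial>x\<^sub>k + \<i> \<partial>/\<partial>y\<^sub>k) w\<close> cancel, which leaves \<open>2 u\<close> times the derivative of \<open>\<psi>\<close>. The derivatives of \<open>w\<close> are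
  bounded: the Cauchy estimate on discs of a fixed radius \<open>r\<close> around points of the support \<open>S\<close>
  bounds \<open>U\<close> by the maximum \<open>M\<close> of \<open>u\<close> over the compact \<open>r\<close>-neighbourhood \<open>T\<close> of \<open>S\<close>.
\<close>

lemma holomorphic_distr_wirtinger_bar_zero:
  assumes "open \<Omega>" and hol: "holomorphic_Cn \<Omega> u" and \<psi>: "\<psi> \<in> test_functions \<Omega>"
  shows "distr_wirtinger_bar \<Omega> k u \<psi> = 0"
proof -
  define S where "S = closure {z. \<psi> z \<noteq> 0}"
  have "compact S" "S \<subseteq> \<Omega>"
    using test_functionsD(3,4)[OF \<psi>] by (auto simp: S_def)
  then obtain r where "r > 0" and r: "(\<Union>x\<in>S. cball x r) \<subseteq> \<Omega>"
    using compact_subset_open_imp_cball_epsilon_subset \<open>open \<Omega>\<close> by blast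
  define T where "T = {x + y |x y. x \<in> S \<and> y \<in> cball 0 r}"
  have "compact T"
    unfolding T_def by (intro compact_sums \<open>compact S\<close> compact_cball)
  have in_T: "x \<in> T" if "z \<in> S" "x \<in> cball z r" for x z
  proof -
    have "z + (x - z) \<in> T"
      unfolding T_def using that
      by (intro CollectI exI[of _ z] exI[of _ "x - z"] conjI refl) (auto simp: dist_norm norm_minus_commute)
    then show ?thesis
      by simp
  qed
  have "T \<subseteq> \<Omega>"
  proof
    fix x assume "x \<in> T"
    then obtain z y where "z \<in> S" "y \<in> cball 0 r" "x = z + y"
      by (auto simp: T_def)
    then have "x \<in> cball z r"
      by (simp add: dist_norm)
    with r \<open>z \<in> S\<close> show "x \<in> \<Omega>"
      by blast
  qed
  obtain U where U: "\<And>z. z \<in> \<Omega> \<Longrightarrow> (u has_derivative U z) (at z)"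
    and U_lin: "\<And>z c v. z \<in> \<Omega> \<Longrightarrow> U z (c *s v) = c * U z v"
    using hol unfolding holomorphic_Cn_def by metis
  let ?\<Psi> = "\<lambda>z. frechet_derivative \<psi> (at z)"
  have \<Psi>: "(\<psi> has_derivative ?\<Psi> z) (at z)" for z
    using test_functionsD(1)[OF \<psi>] by (simp add: frechet_derivative_works)
  have cont_u: "continuous_on T u"
    using U \<open>T \<subseteq> \<Omega>\<close> by (meson continuous_at_imp_continuous_on has_derivative_continuous subsetD)
  obtain M where M: "\<And>z. z \<in> T \<Longrightarrow> cmod (u z) \<le> M"
    using compact_imp_bounded[OF compact_continuous_image[OF cont_u \<open>compact T\<close>]]
    by (auto simp: bounded_iff)
  have cont_\<psi>: "continuous_on S \<psi>"
    using \<Psi> by (meson continuous_at_imp_continuous_on has_derivative_continuous)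
  obtain N where N: "\<And>z. z \<in> S \<Longrightarrow> cmod (\<psi> z) \<le> N"
    using compact_imp_bounded[OF compact_continuous_image[OF cont_\<psi> \<open>compact S\<close>]]
    by (auto simp: bounded_iff)
  define w where "w z = (if z \<in> S then u z * \<psi> z else 0)" for z
  define D where "D z v = (if z \<in> S then u z * ?\<Psi> z v + U z v * \<psi> z else 0)" for z v
  have \<psi>_zero: "\<psi> z = 0" if "z \<notin> S" for z
    using that closure_subset[of "{z. \<psi> z \<noteq> 0}"] by (auto simp: S_def)
  have D: "(w has_derivative D z) (at z)" for z
  proof (cases "z \<in> S")
    case True
    then have "z \<in> \<Omega>"
      using \<open>S \<subseteq> \<Omega>\<close> by auto
    have "((\<lambda>z. u z * \<psi> z) has_derivative (\<lambda>v. u z * ?\<Psi> z v + U z v * \<psi> z)) (at z)"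
      by (rule has_derivative_mult[OF U[OF \<open>z \<in> \<Omega>\<close>] \<Psi>])
    moreover have "(\<lambda>v. u z * ?\<Psi> z v + U z v * \<psi> z) = D z"
      using True by (simp add: D_def fun_eq_iff)
    moreover have "w = (\<lambda>z. u z * \<psi> z)"
      by (auto simp: w_def fun_eq_iff \<psi>_zero)
    ultimately show ?thesis
      by simp
  next
    case False
    have "{z. w z \<noteq> 0} \<subseteq> S"
      by (auto simp: w_def)
    then have "closure {z. w z \<noteq> 0} \<subseteq> S"
      using compact_imp_closed[OF \<open>compact S\<close>] by (rule closure_minimal)
    with False have "(w has_derivative (\<lambda>_. 0)) (at z)"
      by (intro has_derivative_zero_off_closure) auto
    moreover have "D z = (\<lambda>_. 0)"
      using False by (simp add: D_def fun_eq_iff)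
    ultimately show ?thesis
      by simp
  qed
  have key: "integrable lborel (\<lambda>z. D z (axis k c))" "(\<integral>z. D z (axis k c) \<partial>lborel) = 0" if "cmod c = 1" for c
  proof -
    have cont_\<Psi>: "continuous_on S (\<lambda>z. ?\<Psi> z (axis k c))"
      by (rule continuous_on_subset[OF test_functionsD(2)[OF \<psi>]]) auto
    obtain N' where N': "\<And>z. z \<in> S \<Longrightarrow> cmod (?\<Psi> z (axis k c)) \<le> N'"
      using compact_imp_bounded[OF compact_continuous_image[OF cont_\<Psi> \<open>compact S\<close>]]
      by (auto simp: bounded_iff)
    have bound: "cmod (D z (axis k c)) \<le> \<bar>M * N' + M / r * N\<bar>" for z
    proof (cases "z \<in> S")
      case True
      have "z \<in> \<Omega>" "cball z r \<subseteq> \<Omega>" "z \<in> T"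
        using True \<open>S \<subseteq> \<Omega>\<close> r in_T[OF True, of z] \<open>r > 0\<close> by auto
      have "U z (axis k c) = c * U z (axis k 1)"
        using U_lin[OF \<open>z \<in> \<Omega>\<close>, of c "axis k 1"] by (simp add: scalar_mult_axis)
      then have "cmod (U z (axis k c)) \<le> M / r"
        using holomorphic_Cn_cauchy_estimate[OF hol \<open>r > 0\<close> \<open>cball z r \<subseteq> \<Omega>\<close> M[OF in_T[OF True]] U[OF \<open>z \<in> \<Omega>\<close>]] that
        by (simp add: norm_mult)
      then have "cmod (u z * ?\<Psi> z (axis k c)) + cmod (U z (axis k c) * \<psi> z) \<le> M * N' + M / r * N"
        unfolding norm_mult using M[OF \<open>z \<in> T\<close>] N[OF True] N'[OF True]
        by (intro add_mono mult_mono) (auto intro: order_trans[OF norm_ge_zero])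
      then have "cmod (D z (axis k c)) \<le> M * N' + M / r * N"
        using True norm_triangle_ineq[of "u z * ?\<Psi> z (axis k c)" "U z (axis k c) * \<psi> z"]
        by (simp add: D_def)
      then show ?thesis
        by simp
    qed (simp add: D_def)
    show "integrable lborel (\<lambda>z. D z (axis k c))" "(\<integral>z. D z (axis k c) \<partial>lborel) = 0"
      using integral_directional_derivative_zero[OF D bound \<open>compact S\<close>] by (auto simp: w_def)
  qed
  let ?h = "\<lambda>z. (D z (axis k 1) + \<i> * D z (axis k \<i>)) / 2"
  have pointwise: "indicator \<Omega> z *\<^sub>R (u z * wirtinger_bar k \<psi> z) = ?h z" for z
  proof (cases "z \<in> S")
    case True
    then have "z \<in> \<Omega>"
      using \<open>S \<subseteq> \<Omega>\<close> by auto
    have "U z (axis k \<i>) = \<i> * U z (axis k 1)"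
      using U_lin[OF \<open>z \<in> \<Omega>\<close>, of \<i> "axis k 1"] by (simp add: scalar_mult_axis)
    with True \<open>z \<in> \<Omega>\<close> show ?thesis
      by (simp add: D_def wirtinger_bar_def field_simps)
  next
    case False
    then show ?thesis
      using wirtinger_bar_zero_off_support[of z \<psi> k] by (simp add: D_def S_def)
  qed
  have int: "integrable lborel ?h"
    using key[of 1] key[of \<i>] by simp
  have "(\<integral>z. u z * wirtinger_bar k \<psi> z \<partial>lebesgue_on \<Omega>) =
      (\<integral>z. indicator \<Omega> z *\<^sub>R (u z * wirtinger_bar k \<psi> z) \<partial>lebesgue)"
    using \<open>open \<Omega>\<close> by (intro integral_restrict_space) simp
  also have "\<dots> = (\<integral>z. ?h z \<partial>lebesgue)"
    by (simp only: pointwise)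
  also have "\<dots> = (\<integral>z. ?h z \<partial>lborel)"
    using borel_measurable_integrable[OF int] by (rule integral_completion)
  also have "\<dots> = 0"
    using key[of 1] key[of \<i>] by simp
  finally show ?thesis
    by (simp add: distr_wirtinger_bar_def)
qed

lemma A2_forms_subset_K2:
  assumes "open \<Omega>" "f \<in> A2_forms p q \<Omega>"
  shows "f \<in> K2_forms p q \<Omega>"
proof -
  have "dbar p \<Omega> f I M \<psi> = 0"
    if "(I, M) \<in> multi_indices p (q + 1)" "\<psi> \<in> test_functions \<Omega>" for I M \<psi>
  proof -
    have "distr_wirtinger_bar \<Omega> k (f I (M - {k})) \<psi> = 0" if "k \<in> M" for k
      using assms multi_indices_remove[OF \<open>(I, M) \<in> _\<close> that] \<open>\<psi> \<in> _\<close>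
      by (intro holomorphic_distr_wirtinger_bar_zero) (auto simp: A2_forms_def)
    then show ?thesis
      by (simp add: dbar_def)
  qed
  then show ?thesis
    using assms(2) by (auto simp: A2_forms_def K2_forms_def)
qed


section \<open>Exterior multiplication, contraction and the commutators\<close>

text \<open>
  The form \<open>d(cnj z\<^sub>k) \<and> f\<close>, for a form \<open>f\<close> with \<open>p\<close> factors \<open>dz\<^sub>i\<close>.
\<close>

definition wedge_dzbar :: "nat \<Rightarrow> 'n \<Rightarrow> 'n::{finite,linorder} form \<Rightarrow> 'n form" where
  "wedge_dzbar p k f = (\<lambda>I J z. if k \<in> J then dbar_sign p k J * f I (J - {k}) z else 0)"

text \<open>
  Up to the factor \<open>1/(q+1)\<close>, the interior product of \<open>f\<close> with \<open>\<partial>/\<partial>(cnj z\<^sub>k)\<close>. Wedging the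
  contractions with \<open>d(cnj z\<^sub>k)\<close> and summing over \<open>k\<close> recovers \<open>f\<close>: each coefficient of a
  \<open>(p,q+1)\<close>-form arises \<open>q + 1\<close> times, once for every entry of its multi-index.
\<close>

definition contract_dzbar :: "nat \<Rightarrow> nat \<Rightarrow> 'n \<Rightarrow> 'n::{finite,linorder} form \<Rightarrow> 'n form" where
  "contract_dzbar p q k f =
     (\<lambda>I J z. if k \<in> J then 0 else dbar_sign p k (insert k J) / of_nat (q + 1) * f I (insert k J) z)"

lemma multi_indices_insert:
  "(I, J) \<in> multi_indices p q \<Longrightarrow> k \<notin> J \<Longrightarrow> (I, insert k J) \<in> multi_indices p (q + 1)"
  for J :: "'n::finite set"
  by (simp add: multi_indices_def)

lemma wedge_dzbar_diff: "wedge_dzbar p k (f - g) = wedge_dzbar p k f - wedge_dzbar p k g"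
  by (simp add: wedge_dzbar_def fun_eq_iff algebra_simps)

lemma wedge_dzbar_L2:
  fixes \<Omega> :: "'n::{finite,linorder} cvec set"
  assumes "f \<in> L2_forms p q \<Omega>"
  shows "wedge_dzbar p k f \<in> L2_forms p (q + 1) \<Omega>"
proof (rule L2_formsI)
  fix I J :: "'n set" assume "(I, J) \<in> multi_indices p (q + 1)"
  then show "square_integrable \<Omega> (wedge_dzbar p k f I J)"
    using L2_forms_component[OF assms multi_indices_remove[of I J p q k]]
    by (cases "k \<in> J") (auto simp: wedge_dzbar_def intro: square_integrable_zero square_integrable_scale)
qed

lemma contract_dzbar_component:
  "k \<notin> J \<Longrightarrow> contract_dzbar p q k f I J =
    (\<lambda>z. dbar_sign p k (insert k J) / of_nat (q + 1) * f I (insert k J) z)"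
  by (simp add: contract_dzbar_def)

lemma contract_dzbar_L2:
  fixes \<Omega> :: "'n::{finite,linorder} cvec set"
  assumes "f \<in> L2_forms p (q + 1) \<Omega>"
  shows "contract_dzbar p q k f \<in> L2_forms p q \<Omega>"
proof (rule L2_formsI)
  fix I J :: "'n set" assume IJ: "(I, J) \<in> multi_indices p q"
  show "square_integrable \<Omega> (contract_dzbar p q k f I J)"
  proof (cases "k \<in> J")
    case True
    then show ?thesis
      by (simp add: contract_dzbar_def square_integrable_zero)
  next
    case False
    show ?thesis
      unfolding contract_dzbar_component[OF False]
      by (intro square_integrable_scale L2_forms_component[OF assms] multi_indices_insert[OF IJ False])
  qed
qed

lemma norm_dbar_sign [simp]: "cmod (dbar_sign p k M) = 1"
  by (simp add: dbar_sign_def norm_power)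

text \<open>
  Up to sign, the coefficients of \<open>d(cnj z\<^sub>k) \<and> f\<close> are distinct coefficients of \<open>f\<close>.
\<close>

lemma form_norm_wedge_dzbar_le: "form_norm p (q + 1) \<Omega> (wedge_dzbar p k f) \<le> form_norm p q \<Omega> f"
proof (rule power2_le_imp_le)
  let ?a = "\<lambda>f (I, J). \<integral>z. (cmod (f I J z))\<^sup>2 \<partial>lebesgue_on \<Omega>"
  have "(\<Sum>x\<in>multi_indices p (q + 1). ?a (wedge_dzbar p k f) x) =
      (\<Sum>x\<in>{x \<in> multi_indices p (q + 1). k \<in> snd x}. ?a (wedge_dzbar p k f) x)"
    by (intro sum.mono_neutral_right ballI) (auto, clarsimp simp: wedge_dzbar_def)
  also have "\<dots> \<le> (\<Sum>x\<in>multi_indices p q. ?a f x)"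
  proof (rule sum_le_included[where i = "\<lambda>(I, J). (I, insert k J)"])
    show "\<forall>x\<in>{x \<in> multi_indices p (q + 1). k \<in> snd x}. \<exists>y\<in>multi_indices p q.
        (case y of (I, J) \<Rightarrow> (I, insert k J)) = x \<and> ?a (wedge_dzbar p k f) x \<le> ?a f y"
    proof
      fix x assume x: "x \<in> {x \<in> multi_indices p (q + 1). k \<in> snd x}"
      obtain I J where [simp]: "x = (I, J)"
        by (cases x)
      have "(I, J - {k}) \<in> multi_indices p q"
        using x by (intro multi_indices_remove) auto
      moreover have "?a (wedge_dzbar p k f) x \<le> ?a f (I, J - {k})"
        using x by (simp add: wedge_dzbar_def norm_mult)
      ultimately show "\<exists>y\<in>multi_indices p q.
          (case y of (I, J) \<Rightarrow> (I, insert k J)) = x \<and> ?a (wedge_dzbar p k f) x \<le> ?a f y"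
        using x by (intro bexI[of _ "(I, J - {k})"]) auto
    qed
  qed (auto intro!: integral_nonneg)
  finally show "(form_norm p (q + 1) \<Omega> (wedge_dzbar p k f))\<^sup>2 \<le> (form_norm p q \<Omega> f)\<^sup>2"
    unfolding form_norm_square .
qed simp

lemma form_norm_contract_dzbar_le:
  "form_norm p q \<Omega> (contract_dzbar p q k f) \<le> form_norm p (q + 1) \<Omega> f"
proof (rule power2_le_imp_le)
  let ?a = "\<lambda>f (I, J). \<integral>z. (cmod (f I J z))\<^sup>2 \<partial>lebesgue_on \<Omega>"
  have "(\<Sum>x\<in>multi_indices p q. ?a (contract_dzbar p q k f) x) =
      (\<Sum>x\<in>{x \<in> multi_indices p q. k \<notin> snd x}. ?a (contract_dzbar p q k f) x)"
    by (intro sum.mono_neutral_right) (auto simp: contract_dzbar_def)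
  also have "\<dots> \<le> (\<Sum>x\<in>multi_indices p (q + 1). ?a f x)"
  proof (rule sum_le_included[where i = "\<lambda>(I, J). (I, J - {k})"])
    show "\<forall>x\<in>{x \<in> multi_indices p q. k \<notin> snd x}. \<exists>y\<in>multi_indices p (q + 1).
        (case y of (I, J) \<Rightarrow> (I, J - {k})) = x \<and> ?a (contract_dzbar p q k f) x \<le> ?a f y"
    proof
      fix x assume x: "x \<in> {x \<in> multi_indices p q. k \<notin> snd x}"
      obtain I J where [simp]: "x = (I, J)"
        by (cases x)
      have "(I, insert k J) \<in> multi_indices p (q + 1)"
        using x by (intro multi_indices_insert) auto
      moreover have "?a (contract_dzbar p q k f) x \<le> ?a f (I, insert k J)"
      proof -
        have "?a (contract_dzbar p q k f) x = (1 / real (q + 1))\<^sup>2 * ?a f (I, insert k J)"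
          using x by (simp add: contract_dzbar_def norm_mult norm_divide power_mult_distrib power_divide del: of_nat_Suc of_nat_add)
        also have "\<dots> \<le> 1 * ?a f (I, insert k J)"
          by (intro mult_right_mono power_le_one) (auto intro!: integral_nonneg)
        finally show ?thesis
          by simp
      qed
      ultimately show "\<exists>y\<in>multi_indices p (q + 1).
          (case y of (I, J) \<Rightarrow> (I, J - {k})) = x \<and> ?a (contract_dzbar p q k f) x \<le> ?a f y"
        using x by (intro bexI[of _ "(I, insert k J)"]) auto
    qed
  qed (auto intro!: integral_nonneg)
  finally show "(form_norm p q \<Omega> (contract_dzbar p q k f))\<^sup>2 \<le> (form_norm p (q + 1) \<Omega> f)\<^sup>2"
    unfolding form_norm_square .
qed simp

lemma card_less_remove:
  fixes M :: "'n::{finite,linorder} set"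
  assumes "k \<in> M"
  shows "card {j\<in>M. j < l} = card {j\<in>M - {k}. j < l} + (if k < l then 1 else 0)"
proof (cases "k < l")
  case True
  then have "{j\<in>M. j < l} = insert k {j\<in>M - {k}. j < l}"
    using assms by auto
  moreover have "k \<notin> {j\<in>M - {k}. j < l}"
    by simp
  ultimately show ?thesis
    using True by simp
next
  case False
  then have "{j\<in>M. j < l} = {j\<in>M - {k}. j < l}"
    by auto
  with False show ?thesis
    by simp
qed

text \<open>
  This is \<open>d(cnj z\<^sub>l) \<and> d(cnj z\<^sub>k) = - d(cnj z\<^sub>k) \<and> d(cnj z\<^sub>l)\<close>: removing the smaller of the two indices shifts the
  position of the larger one, and not conversely.
\<close>

lemma dbar_sign_anticommute:
  fixes M :: "'n::{finite,linorder} set"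
  assumes "k \<in> M" "l \<in> M" "k \<noteq> l"
  shows "dbar_sign p l M * dbar_sign p k (M - {l}) = - (dbar_sign p k M * dbar_sign p l (M - {k}))"
proof (cases "k < l")
  case True
  then show ?thesis
    unfolding dbar_sign_def card_less_remove[OF assms(1), of l] card_less_remove[OF assms(2), of k]
    by (simp add: power_add)
next
  case False
  then have "l < k"
    using assms(3) by auto
  then show ?thesis
    unfolding dbar_sign_def card_less_remove[OF assms(1), of l] card_less_remove[OF assms(2), of k]
    by (simp add: power_add)
qed

lemma distr_wirtinger_bar_scale:
  "distr_wirtinger_bar \<Omega> k (\<lambda>z. c * u z) \<psi> = c * distr_wirtinger_bar \<Omega> k u \<psi>"
  by (simp add: distr_wirtinger_bar_def mult.assoc)

text \<open>
  The identity \<open>dbar (d(cnj z\<^sub>k) \<and> f) = - d(cnj z\<^sub>k) \<and> dbar f\<close> for the coefficients with \<open>k \<in> M\<close>; the term for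
  \<open>l = k\<close> on the left vanishes, and the others correspond with opposite sign.
\<close>

lemma dbar_wedge_dzbar:
  assumes "k \<in> M"
  shows "dbar p \<Omega> (wedge_dzbar p k f) I M \<psi> = - dbar_sign p k M * dbar p \<Omega> f I (M - {k}) \<psi>"
proof -
  have "dbar p \<Omega> (wedge_dzbar p k f) I M \<psi> =
      (\<Sum>l\<in>M. dbar_sign p l M * distr_wirtinger_bar \<Omega> l (wedge_dzbar p k f I (M - {l})) \<psi>)"
    by (simp add: dbar_def dbar_sign_def)
  also have "\<dots> = (\<Sum>l\<in>M - {k}. dbar_sign p l M * distr_wirtinger_bar \<Omega> l (wedge_dzbar p k f I (M - {l})) \<psi>)"
    by (intro sum.mono_neutral_right)
      (auto simp: wedge_dzbar_def distr_wirtinger_bar_def)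
  also have "\<dots> = (\<Sum>l\<in>M - {k}. - dbar_sign p k M *
      (dbar_sign p l (M - {k}) * distr_wirtinger_bar \<Omega> l (f I (M - {k} - {l})) \<psi>))"
  proof (intro sum.cong refl)
    fix l assume l: "l \<in> M - {k}"
    have "wedge_dzbar p k f I (M - {l}) = (\<lambda>z. dbar_sign p k (M - {l}) * f I (M - {k} - {l}) z)"
      using l assms by (auto simp: wedge_dzbar_def fun_eq_iff Diff_insert2[symmetric] insert_commute)
    then have scaled: "dbar_sign p l M * distr_wirtinger_bar \<Omega> l (wedge_dzbar p k f I (M - {l})) \<psi> =
        (dbar_sign p l M * dbar_sign p k (M - {l})) * distr_wirtinger_bar \<Omega> l (f I (M - {k} - {l})) \<psi>"
      by (simp add: distr_wirtinger_bar_scale)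
    have sign: "dbar_sign p l M * dbar_sign p k (M - {l}) = - (dbar_sign p k M * dbar_sign p l (M - {k}))"
      using l assms by (intro dbar_sign_anticommute) auto
    show "dbar_sign p l M * distr_wirtinger_bar \<Omega> l (wedge_dzbar p k f I (M - {l})) \<psi> =
        - dbar_sign p k M * (dbar_sign p l (M - {k}) * distr_wirtinger_bar \<Omega> l (f I (M - {k} - {l})) \<psi>)"
      unfolding scaled sign by simp
  qed
  also have "\<dots> = - dbar_sign p k M * dbar p \<Omega> f I (M - {k}) \<psi>"
    by (simp add: dbar_def dbar_sign_def sum_distrib_left)
  finally show ?thesis .
qed

lemma wedge_dzbar_K2:
  assumes f: "f \<in> K2_forms p q \<Omega>"
  shows "wedge_dzbar p k f \<in> K2_forms p (q + 1) \<Omega>"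
proof -
  have "dbar p \<Omega> (wedge_dzbar p k f) I M \<psi> = 0"
    if IM: "(I, M) \<in> multi_indices p (q + 1 + 1)" and \<psi>: "\<psi> \<in> test_functions \<Omega>" for I M \<psi>
  proof (cases "k \<in> M")
    case True
    have "dbar p \<Omega> f I (M - {k}) \<psi> = 0"
      using f multi_indices_remove[OF IM True] \<psi> by (auto simp: K2_forms_def)
    then show ?thesis
      by (simp add: dbar_wedge_dzbar[OF True])
  next
    case False
    then show ?thesis
      by (simp add: dbar_def wedge_dzbar_def distr_wirtinger_bar_def)
  qed
  then show ?thesis
    using wedge_dzbar_L2[OF K2_forms_L2[OF f]] by (auto simp: K2_forms_def)
qed

lemma holomorphic_Cn_scale:
  assumes "holomorphic_Cn \<Omega> u"
  shows "holomorphic_Cn \<Omega> (\<lambda>z. c * u z)"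
  unfolding holomorphic_Cn_def
proof
  fix z assume "z \<in> \<Omega>"
  then obtain D where "(u has_derivative D) (at z)" "\<And>a v. D (a *s v) = a * D v"
    using assms by (auto simp: holomorphic_Cn_def)
  then show "\<exists>D. ((\<lambda>z. c * u z) has_derivative D) (at z) \<and> (\<forall>a v. D (a *s v) = a * D v)"
    by (intro exI[of _ "\<lambda>v. c * D v"] conjI has_derivative_mult_right) auto
qed

lemma contract_dzbar_A2:
  assumes f: "f \<in> A2_forms p (q + 1) \<Omega>"
  shows "contract_dzbar p q k f \<in> A2_forms p q \<Omega>"
proof -
  have "holomorphic_Cn \<Omega> (contract_dzbar p q k f I J)" if IJ: "(I, J) \<in> multi_indices p q" for I J
  proof (cases "k \<in> J")
    case True
    then show ?thesis
      by (auto simp: contract_dzbar_def holomorphic_Cn_def intro!: exI[of _ "\<lambda>_. 0"])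
  next
    case False
    then have hol: "holomorphic_Cn \<Omega> (f I (insert k J))"
      using f multi_indices_insert[OF IJ] by (auto simp: A2_forms_def)
    show ?thesis
      unfolding contract_dzbar_component[OF False] by (rule holomorphic_Cn_scale[OF hol])
  qed
  moreover have "contract_dzbar p q k f \<in> L2_forms p q \<Omega>"
    using f by (intro contract_dzbar_L2) (simp add: A2_forms_def)
  ultimately show ?thesis
    by (auto simp: A2_forms_def)
qed

lemma sum_wedge_contract:
  fixes f :: "'n::{finite,linorder} form"
  assumes "(I, J) \<in> multi_indices p (q + 1)"
  shows "(\<Sum>k\<in>UNIV. wedge_dzbar p k (contract_dzbar p q k f)) I J = f I J"
proof
  fix z
  have "(\<Sum>k\<in>UNIV. wedge_dzbar p k (contract_dzbar p q k f)) I J z =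
      (\<Sum>k\<in>UNIV. if k \<in> J then f I J z / of_nat (q + 1) else 0)"
    unfolding sum_fun_apply
    by (intro sum.cong refl)
      (auto simp: wedge_dzbar_def contract_dzbar_def insert_absorb dbar_sign_square
        mult.assoc[symmetric] simp del: of_nat_Suc)
  also have "\<dots> = of_nat (card J) * (f I J z / of_nat (q + 1))"
    by (simp add: sum.If_cases del: of_nat_Suc)
  also have "\<dots> = f I J z"
    using assms by (simp add: multi_indices_def del: of_nat_Suc)
  finally show "(\<Sum>k\<in>UNIV. wedge_dzbar p k (contract_dzbar p q k f)) I J z = f I J z" .
qed

lemma contract_dzbar_mult: "contract_dzbar p q k (form_mult \<phi> f) = form_mult \<phi> (contract_dzbar p q k f)"
  by (simp add: contract_dzbar_def fun_eq_iff)

lemma form_norm_cong: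
  assumes "\<And>I J. (I, J) \<in> multi_indices p q \<Longrightarrow> f I J = g I J"
  shows "form_norm p q \<Omega> f = form_norm p q \<Omega> g"
  unfolding form_norm_def using assms by (intro arg_cong[of _ _ sqrt] sum.cong) auto

text \<open>
  Multiplication by \<open>\<phi>\<close> respects equality almost everywhere. It allows \<open>P F\<close> to be replaced by \<open>F\<close> in
  the commutator for closed \<open>F\<close>.
\<close>

lemma form_norm_mult_null:
  assumes \<phi>: "\<phi> \<in> L_infinity \<Omega>" and f: "f \<in> L2_forms p q \<Omega>" and null: "form_norm p q \<Omega> f = 0"
  shows "form_norm p q \<Omega> (form_mult \<phi> f) = 0"
proof -
  have "(\<integral>z. (cmod (\<phi> z * f I J z))\<^sup>2 \<partial>lebesgue_on \<Omega>) = 0" if IJ: "(I, J) \<in> multi_indices p q" for I J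
  proof -
    have "(\<integral>z. (cmod (f I J z))\<^sup>2 \<partial>lebesgue_on \<Omega>) = 0"
      using component_norm_le[OF IJ, of \<Omega> f] null
      by (intro antisym) (auto intro!: integral_nonneg)
    then have "AE z in lebesgue_on \<Omega>. (cmod (f I J z))\<^sup>2 = 0"
      using L2_forms_component[OF f IJ]
      by (subst integral_nonneg_eq_0_iff_AE[symmetric]) (auto simp: square_integrable_def)
    then have "AE z in lebesgue_on \<Omega>. (cmod (\<phi> z * f I J z))\<^sup>2 = 0"
      by eventually_elim simp
    then show ?thesis
      by (rule integral_eq_zero_AE)
  qed
  then show ?thesis
    by (auto simp: form_norm_def intro!: sum.neutral)
qed

lemma bergman_commutator_eq:
  "bergman_commutator p q \<Omega> \<phi> f =
    bergman_proj p q \<Omega> (form_mult \<phi> f) - form_mult \<phi> (bergman_proj p q \<Omega> f)"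
  by (simp add: bergman_commutator_def form_diff_eq_minus)

lemma bergman_commutator_L2:
  assumes "open \<Omega>" "\<phi> \<in> L_infinity \<Omega>" "f \<in> L2_forms p q \<Omega>"
  shows "bergman_commutator p q \<Omega> \<phi> f \<in> L2_forms p q \<Omega>"
  unfolding bergman_commutator_eq
  by (intro L2_forms_diff L2_forms_mult K2_forms_L2 bergman_proj assms)

lemma form_norm_add_null:
  assumes "f \<in> L2_forms p q \<Omega>" "g \<in> L2_forms p q \<Omega>" "form_norm p q \<Omega> g = 0"
  shows "form_norm p q \<Omega> (f + g) \<le> form_norm p q \<Omega> f"
  using form_norm_triangle[OF assms(1,2)] assms(3) by simp

text \<open>
  With \<open>R = \<Sum>\<^sub>k d(cnj z\<^sub>k) \<and> P(\<phi> G\<^sub>k)\<close>, a closed form, put \<open>u = R - \<phi> F - E\<close>. Its projection is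
  \<open>v = R - P(\<phi> F) - P E\<close>, so that \<open>u - v\<close> has norm at most \<open>\<parallel>u\<parallel>\<close>. Almost everywhere, \<open>u - v\<close> is the
  difference of the commutator of \<open>F\<close> and \<open>E - P E\<close>, while \<open>u\<close> is the sum of the forms
  \<open>d(cnj z\<^sub>k) \<and> (T\<^sub>q G\<^sub>k - H\<^sub>k)\<close>.
\<close>

lemma commutator_estimate:
  fixes \<Omega> :: "'n::{finite,linorder} cvec set"
  assumes "open \<Omega>" and \<phi>: "\<phi> \<in> L_infinity \<Omega>"
    and F: "F \<in> A2_forms p (q + 1) \<Omega>" and H: "\<And>k. H k \<in> L2_forms p q \<Omega>"
  defines "E \<equiv> \<Sum>k\<in>UNIV. wedge_dzbar p k (H k)"
  shows "form_norm p (q + 1) \<Omega>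
      (bergman_commutator p (q + 1) \<Omega> \<phi> F - (E - bergman_proj p (q + 1) \<Omega> E)) \<le>
    (\<Sum>k\<in>UNIV. form_norm p q \<Omega> (bergman_commutator p q \<Omega> \<phi> (contract_dzbar p q k F) - H k))"
proof -
  let ?P = "bergman_proj p q \<Omega>" and ?P' = "bergman_proj p (q + 1) \<Omega>"
  let ?G = "\<lambda>k. contract_dzbar p q k F"
  note proj = bergman_proj[OF \<open>open \<Omega>\<close>]
  have FK: "F \<in> K2_forms p (q + 1) \<Omega>"
    by (rule A2_forms_subset_K2[OF \<open>open \<Omega>\<close> F])
  have GK: "?G k \<in> K2_forms p q \<Omega>" for k
    by (intro A2_forms_subset_K2 contract_dzbar_A2 F \<open>open \<Omega>\<close>)
  note FL = K2_forms_L2[OF FK] and GL = K2_forms_L2[OF GK]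
  have EL: "E \<in> L2_forms p (q + 1) \<Omega>"
    unfolding E_def by (intro L2_forms_sum wedge_dzbar_L2 H)
  have \<phi>FL: "form_mult \<phi> F \<in> L2_forms p (q + 1) \<Omega>"
    by (rule L2_forms_mult[OF \<phi> FL])
  have \<phi>GL: "form_mult \<phi> (?G k) \<in> L2_forms p q \<Omega>" for k
    by (rule L2_forms_mult[OF \<phi> GL])
  define R where "R = (\<Sum>k\<in>UNIV. wedge_dzbar p k (?P (form_mult \<phi> (?G k))))"
  have RK: "R \<in> K2_forms p (q + 1) \<Omega>"
    unfolding R_def by (intro K2_forms_sum wedge_dzbar_K2 proj \<phi>GL \<open>open \<Omega>\<close>)
  define u where "u = R - form_mult \<phi> F - E"
  define v where "v = R - ?P' (form_mult \<phi> F) - ?P' E"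
  have uL: "u \<in> L2_forms p (q + 1) \<Omega>"
    unfolding u_def by (intro L2_forms_diff K2_forms_L2[OF RK] \<phi>FL EL)
  have vK: "v \<in> K2_forms p (q + 1) \<Omega>"
    unfolding v_def by (intro K2_forms_diff RK proj \<phi>FL EL \<open>open \<Omega>\<close>)
  have PFL: "?P' (form_mult \<phi> F) \<in> L2_forms p (q + 1) \<Omega>" and PEL: "?P' E \<in> L2_forms p (q + 1) \<Omega>"
    by (intro K2_forms_L2 proj \<phi>FL EL)+
  have "form_inner p (q + 1) \<Omega> (u - v) v = 0"
  proof -
    have "u - v = form_mult (\<lambda>_. -1) ((form_mult \<phi> F - ?P' (form_mult \<phi> F)) + (E - ?P' E))"
      by (simp add: u_def v_def fun_eq_iff)
    then show ?thesis
      using proj(2)[OF \<phi>FL vK] proj(2)[OF EL vK]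
      by (simp add: form_inner_scale_left form_inner_add_left L2_forms_diff \<phi>FL EL PFL PEL K2_forms_L2[OF vK]
          del: One_nat_def add_Suc_right)
  qed
  then have "form_norm p (q + 1) \<Omega> (u - v) \<le> form_norm p (q + 1) \<Omega> u"
    by (rule form_norm_residual_le[OF uL K2_forms_L2[OF vK]])
  moreover have "form_norm p (q + 1) \<Omega> (bergman_commutator p (q + 1) \<Omega> \<phi> F - (E - ?P' E)) \<le>
      form_norm p (q + 1) \<Omega> (u - v)"
  proof -
    have eq: "bergman_commutator p (q + 1) \<Omega> \<phi> F - (E - ?P' E) =
        (u - v) + form_mult \<phi> (F - ?P' F)"
      unfolding bergman_commutator_eq u_def v_def form_mult_diff by simp
    have diffL: "F - ?P' F \<in> L2_forms p (q + 1) \<Omega>"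
      by (intro L2_forms_diff K2_forms_L2 proj FL FK)
    show ?thesis
      unfolding eq
      by (intro form_norm_add_null L2_forms_diff[OF uL K2_forms_L2[OF vK]] L2_forms_mult[OF \<phi> diffL]
          form_norm_mult_null[OF \<phi> diffL] bergman_proj_fixes_K2[OF \<open>open \<Omega>\<close> FK])
  qed
  moreover have "form_norm p (q + 1) \<Omega> u =
      form_norm p (q + 1) \<Omega> (\<Sum>k\<in>UNIV. wedge_dzbar p k (?P (form_mult \<phi> (?G k)) - form_mult \<phi> (?G k) - H k))"
  proof (rule form_norm_cong)
    fix I J :: "'n set" assume IJ: "(I, J) \<in> multi_indices p (q + 1)"
    show "u I J = (\<Sum>k\<in>UNIV. wedge_dzbar p k (?P (form_mult \<phi> (?G k)) - form_mult \<phi> (?G k) - H k)) I J"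
      using sum_wedge_contract[OF IJ, of "form_mult \<phi> F"]
      unfolding u_def R_def E_def wedge_dzbar_diff sum_subtractf contract_dzbar_mult by simp
  qed
  moreover have "form_norm p (q + 1) \<Omega>
      (\<Sum>k\<in>UNIV. wedge_dzbar p k (?P (form_mult \<phi> (?G k)) - form_mult \<phi> (?G k) - H k)) \<le>
    (\<Sum>k\<in>UNIV. form_norm p (q + 1) \<Omega>
      (wedge_dzbar p k (?P (form_mult \<phi> (?G k)) - form_mult \<phi> (?G k) - H k)))"
    by (intro form_norm_sum_le wedge_dzbar_L2 L2_forms_diff H \<phi>GL K2_forms_L2 proj)
  moreover have "form_norm p (q + 1) \<Omega> (wedge_dzbar p k (?P (form_mult \<phi> (?G k)) - form_mult \<phi> (?G k) - H k)) \<le>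
      form_norm p q \<Omega> (bergman_commutator p q \<Omega> \<phi> (?G k) - H k)" for k
  proof -
    have eq: "?P (form_mult \<phi> (?G k)) - form_mult \<phi> (?G k) - H k =
        (bergman_commutator p q \<Omega> \<phi> (?G k) - H k) + form_mult \<phi> (?P (?G k) - ?G k)"
      unfolding bergman_commutator_eq form_mult_diff by simp
    have diffL: "?P (?G k) - ?G k \<in> L2_forms p q \<Omega>"
      by (intro L2_forms_diff K2_forms_L2 proj GL GK)
    have null: "form_norm p q \<Omega> (?P (?G k) - ?G k) = 0"
      using bergman_proj_fixes_K2[OF \<open>open \<Omega>\<close> GK] by (subst form_norm_minus_commute)
    show ?thesis
      unfolding eq
      by (intro order_trans[OF form_norm_wedge_dzbar_le] form_norm_add_null
          L2_forms_diff bergman_commutator_L2[OF \<open>open \<Omega>\<close> \<phi> GL] H L2_forms_mult[OF \<phi> diffL]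
          form_norm_mult_null[OF \<phi> diffL null])
  qed
  then have "(\<Sum>k\<in>UNIV. form_norm p (q + 1) \<Omega>
      (wedge_dzbar p k (?P (form_mult \<phi> (?G k)) - form_mult \<phi> (?G k) - H k))) \<le>
    (\<Sum>k\<in>UNIV. form_norm p q \<Omega> (bergman_commutator p q \<Omega> \<phi> (?G k) - H k))"
    by (rule sum_mono)
  ultimately show ?thesis
    by linarith
qed

text \<open>
  Finitely many bounded sequences are treated one after the other, each time passing to a further
  subsequence, which keeps the convergence obtained before.
\<close>

lemma compact_operator_on_common_subsequence:
  fixes G :: "'i \<Rightarrow> nat \<Rightarrow> 'n::finite form"
  assumes T: "compact_operator_on p q \<Omega> T S" and "finite A"
    and G: "\<And>k j. k \<in> A \<Longrightarrow> G k j \<in> S" and bound: "\<And>k j. k \<in> A \<Longrightarrow> form_norm p q \<Omega> (G k j) \<le> C"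
  shows "\<exists>r H. strict_mono r \<and> (\<forall>k\<in>A. H k \<in> L2_forms p q \<Omega> \<and>
    (\<lambda>j. form_norm p q \<Omega> (T (G k (r j)) - H k)) \<longlonglongrightarrow> 0)"
  using \<open>finite A\<close> G bound
proof (induction A)
  case empty
  show ?case
    by (intro exI[of _ id]) (auto simp: strict_mono_def)
next
  case (insert k A)
  then obtain r H where r: "strict_mono r" and H: "\<And>i. i \<in> A \<Longrightarrow> H i \<in> L2_forms p q \<Omega>"
    and lim: "\<And>i. i \<in> A \<Longrightarrow> (\<lambda>j. form_norm p q \<Omega> (T (G i (r j)) - H i)) \<longlonglongrightarrow> 0"
    by (metis insertCI)
  have "(\<forall>j. G k (r j) \<in> S) \<and> (\<exists>C. \<forall>j. form_norm p q \<Omega> (G k (r j)) \<le> C)"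
    using insert.prems by blast
  then obtain s h where s: "strict_mono s" and h: "h \<in> L2_forms p q \<Omega>"
    and lim_h: "(\<lambda>j. form_norm p q \<Omega> (T (G k (r (s j))) - h)) \<longlonglongrightarrow> 0"
    using T[unfolded compact_operator_on_def, THEN conjunct2, rule_format, of "\<lambda>j. G k (r j)"]
    unfolding form_diff_eq_minus by blast
  have lim_s: "(\<lambda>j. form_norm p q \<Omega> (T (G i (r (s j))) - H i)) \<longlonglongrightarrow> 0" if "i \<in> A" for i
    using LIMSEQ_subseq_LIMSEQ[OF lim[OF that] s] by (simp add: o_def)
  show ?case
  proof (intro exI conjI ballI)
    show "strict_mono (r \<circ> s)"
      by (rule strict_mono_o[OF r s])
    fix i assume "i \<in> insert k A"
    then show "(H(k := h)) i \<in> L2_forms p q \<Omega>"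
      using H h by auto
    show "(\<lambda>j. form_norm p q \<Omega> (T (G i ((r \<circ> s) j)) - (H(k := h)) i)) \<longlonglongrightarrow> 0"
      using \<open>i \<in> insert k A\<close> lim_h lim_s \<open>k \<notin> A\<close> by (cases "i = k") auto
  qed
qed

theorem corollary2:
  fixes \<Omega> :: "'n::{finite,linorder} cvec set"
    and \<phi> :: "'n cvec \<Rightarrow> complex"
    and p q :: nat
  assumes "open \<Omega>" and "connected \<Omega>" and "\<Omega> \<noteq> {}"
    and "p \<le> CARD('n)" and "q \<le> CARD('n) - 1"
    and "\<phi> \<in> L_infinity \<Omega>"
    and "compact_operator_on p q \<Omega> (bergman_commutator p q \<Omega> \<phi>) (A2_forms p q \<Omega>)"
  shows "compact_operator_on p (q + 1) \<Omega> (bergman_commutator p (q + 1) \<Omega> \<phi>)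
           (A2_forms p (q + 1) \<Omega>)"
  unfolding compact_operator_on_def
proof (intro conjI allI impI; (elim conjE exE)?)
  show "bergman_commutator p (q + 1) \<Omega> \<phi> ` A2_forms p (q + 1) \<Omega> \<subseteq> L2_forms p (q + 1) \<Omega>"
    using bergman_commutator_L2[OF \<open>open \<Omega>\<close> \<open>\<phi> \<in> _\<close>] by (auto simp: A2_forms_def)
next
  fix F :: "nat \<Rightarrow> 'n form" and C
  assume F: "\<forall>j. F j \<in> A2_forms p (q + 1) \<Omega>" and C: "\<forall>j. form_norm p (q + 1) \<Omega> (F j) \<le> C"
  let ?G = "\<lambda>k j. contract_dzbar p q k (F j)"
  have "form_norm p q \<Omega> (?G k j) \<le> C" for k j
    using C order_trans[OF form_norm_contract_dzbar_le] by blast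
  moreover have "?G k j \<in> A2_forms p q \<Omega>" for k j
    using F by (intro contract_dzbar_A2) simp
  ultimately obtain r H where r: "strict_mono r" and H_lim: "\<forall>k\<in>UNIV. H k \<in> L2_forms p q \<Omega> \<and>
      (\<lambda>j. form_norm p q \<Omega> (bergman_commutator p q \<Omega> \<phi> (?G k (r j)) - H k)) \<longlonglongrightarrow> 0"
    using compact_operator_on_common_subsequence[OF assms(7) finite_class.finite_UNIV, of ?G C] by blast
  then have H: "\<And>k. H k \<in> L2_forms p q \<Omega>"
    and lim: "\<And>k. (\<lambda>j. form_norm p q \<Omega> (bergman_commutator p q \<Omega> \<phi> (?G k (r j)) - H k)) \<longlonglongrightarrow> 0"
    by blast+
  define E where "E = (\<Sum>k\<in>UNIV. wedge_dzbar p k (H k))"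
  let ?g = "E - bergman_proj p (q + 1) \<Omega> E"
  have EL: "E \<in> L2_forms p (q + 1) \<Omega>"
    unfolding E_def by (intro L2_forms_sum wedge_dzbar_L2 H)
  then have "?g \<in> L2_forms p (q + 1) \<Omega>"
    by (rule L2_forms_diff[OF _ K2_forms_L2[OF bergman_proj(1)[OF \<open>open \<Omega>\<close> EL]]])
  moreover have "(\<lambda>j. form_norm p (q + 1) \<Omega> (bergman_commutator p (q + 1) \<Omega> \<phi> (F (r j)) - ?g)) \<longlonglongrightarrow> 0"
  proof (rule tendsto_sandwich[OF _ _ tendsto_const])
    show "(\<lambda>j. \<Sum>k\<in>UNIV. form_norm p q \<Omega> (bergman_commutator p q \<Omega> \<phi> (?G k (r j)) - H k)) \<longlonglongrightarrow> 0"
      by (intro tendsto_null_sum lim)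
    show "\<forall>\<^sub>F j in sequentially. form_norm p (q + 1) \<Omega> (bergman_commutator p (q + 1) \<Omega> \<phi> (F (r j)) - ?g) \<le>
        (\<Sum>k\<in>UNIV. form_norm p q \<Omega> (bergman_commutator p q \<Omega> \<phi> (?G k (r j)) - H k))"
      unfolding E_def
      by (intro always_eventually allI commutator_estimate[OF \<open>open \<Omega>\<close> \<open>\<phi> \<in> _\<close> F[rule_format] H])
  qed (simp add: always_eventually)
  ultimately show "\<exists>r g. strict_mono r \<and> g \<in> L2_forms p (q + 1) \<Omega> \<and>
      (\<lambda>j. form_norm p (q + 1) \<Omega> (form_diff (bergman_commutator p (q + 1) \<Omega> \<phi> (F (r j))) g)) \<longlonglongrightarrow> 0"
    unfolding form_diff_eq_minus using r by blast
qed

end
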